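(* Let $d\ge 1$ be an integer and let $p,q$ be real numbers with $2-d\le p<0<q\le 2$. Let $K(x)=|x|^q/q-|x|^p/p$ on $\mathbb{R}^d$ and $\mathsf{E}(\mu)=\int_{\mathbb{R}^d}\int_{\mathbb{R}^d}K(x-y)\,d\mu(x)\,d\mu(y)$. Let $\varphi:\mathbb{R}^d\to\mathbb{R}$ be a mollifier satisfying: $\varphi\in C^\infty(\mathbb{R}^d)$ is radial and nonnegative; $\int_{\mathbb{R}^d}\varphi(x)\,dx=1$; and $\varphi(x)\le C|x|^{-l}$ for some $l\ge\max\{2d+1,4\}$ and $C>0$. For $\epsilon>0$ let $\varphi_\epsilon(x)=\epsilon^{-d}\varphi(x/\epsilon)$, $K_\epsilon=\varphi_\epsilon*K*\varphi_\epsilon$ and $\mathsf{E}_\epsilon(\mu)=\int_{\mathbb{R}^d}\int_{\mathbb{R}^d}K_\epsilon(x-y)\,d\mu(x)\,d\mu(y)$. For every sufficiently small $\epsilon>0$ let $\mu_\epsilon\in\mathcal{P}_2(\mathbb{R}^d)$ be a minimizer of $\mathsf{E}_\epsilon$ over $\mathcal{P}_2(\mathbb{R}^d)$. Then there exists $\mu\in\mathcal{P}_2(\mathbb{R}^d)$ such that, up to a subsequence and translations, $\mu_\epsilon\to\mu$ in $(\mathcal{P}_2(\mathbb{R}^d),d_W)$ as $\epsilon\to0$ (that is, there are $\epsilon_k\to0$ and $y_k\in\mathbb{R}^d$ such that the translates of $\mu_{\epsilon_k}$ by $y_k$ converge to $\mu$ in $d_W$), and $\mu$ minimizes $\mathsf{E}$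 over $\mathcal{P}_2(\mathbb{R}^d)$.
   Context: $\mathcal{P}_2(\mathbb{R}^d)$ is the set of Borel probability measures on $\mathbb{R}^d$ with finite second moment, and $d_W$ is the 2-Wasserstein distance on it: $d_W(\mu,\nu)^2=\min_\gamma\int|x-y|^2\,d\gamma(x,y)$ over all couplings $\gamma$ of $\mu$ and $\nu$. The kernel $K$ takes the value $+\infty$ at $x=0$ (since $p<0$), and $\mathsf{E}$ may take the value $+\infty$. The condition $2-d\le p<0$ forces $d\ge3$. *)

theory Defs
  imports "HOL-Probability.Probability"
begin

fun Ck :: "nat \<Rightarrow> ('a::euclidean_space \<Rightarrow> real) \<Rightarrow> bool" where
  "Ck 0 f \<longleftrightarrow> continuous_on UNIV f"
| "Ck (Suc k) f \<longleftrightarrow>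
     (\<forall>x. f differentiable (at x)) \<and> (\<forall>b\<in>Basis. Ck k (\<lambda>x. frechet_derivative f (at x) b))"

definition smooth :: "('a::euclidean_space \<Rightarrow> real) \<Rightarrow> bool" where
  "smooth f \<longleftrightarrow> (\<forall>k. Ck k f)"

definition radial :: "('a::real_normed_vector \<Rightarrow> real) \<Rightarrow> bool" where
  "radial f \<longleftrightarrow> (\<exists>g. \<forall>x. f x = g (norm x))"

definition P2 :: "'a::euclidean_space measure set" where
  "P2 = {\<mu>. prob_space \<mu> \<and> sets \<mu> = sets borel \<and> (\<integral>\<^sup>+x. ennreal ((norm x)\<^sup>2) \<partial>\<mu>) < \<infinity>}"

definition couplings ::
  "'a::euclidean_space measure \<Rightarrow> 'a measure \<Rightarrow> ('a \<times> 'a) measure set" where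
  "couplings \<mu> \<nu> = {\<gamma>. sets \<gamma> = sets borel \<and> distr \<gamma> borel fst = \<mu> \<and> distr \<gamma> borel snd = \<nu>}"

text \<open>
  The infimum of the transport cost is attained. It is finite on \<open>P2\<close>, by the product coupling,
  so there the convention \<open>enn2real \<infinity> = 0\<close> plays no role.
\<close>
definition dW :: "'a::euclidean_space measure \<Rightarrow> 'a measure \<Rightarrow> real" where
  "dW \<mu> \<nu> =
     sqrt (enn2real (INF \<gamma>\<in>couplings \<mu> \<nu>. \<integral>\<^sup>+(x, y). ennreal ((norm (x - y))\<^sup>2) \<partial>\<gamma>))"

definition translate :: "'a::euclidean_space \<Rightarrow> 'a measure \<Rightarrow> 'a measure" where
  "translate y \<mu> = distr \<mu> borel (\<lambda>x. x + y)"

text \<open>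
  The kernel is meant for \<open>p < 0 < q\<close>. Then it is nonnegative, so that \<^const>\<open>ennreal\<close> truncates
  nothing and all integrals below are integrals of nonnegative functions.
  The case \<open>x = 0\<close> is separate because \<open>0 powr p = 0\<close>.
\<close>
definition power_kernel :: "real \<Rightarrow> real \<Rightarrow> 'a::euclidean_space \<Rightarrow> ennreal" where
  "power_kernel p q x =
     (if x = 0 then \<infinity> else ennreal (norm x powr q / q - norm x powr p / p))"

definition conv ::
  "('a::euclidean_space \<Rightarrow> ennreal) \<Rightarrow> ('a \<Rightarrow> ennreal) \<Rightarrow> 'a \<Rightarrow> ennreal" where
  "conv f g x = (\<integral>\<^sup>+y. f (x - y) * g y \<partial>lborel)"

definition rescale :: "real \<Rightarrow> (real ^ 'n \<Rightarrow> real) \<Rightarrow> real ^ 'n \<Rightarrow> real" where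
  "rescale \<epsilon> \<phi> x = \<phi> (x /\<^sub>R \<epsilon>) / \<epsilon> ^ CARD('n)"

definition kernel_eps ::
  "real \<Rightarrow> real \<Rightarrow> (real ^ 'n \<Rightarrow> real) \<Rightarrow> real \<Rightarrow> real ^ 'n \<Rightarrow> ennreal" where
  "kernel_eps p q \<phi> \<epsilon> =
     conv (conv (\<lambda>x. ennreal (rescale \<epsilon> \<phi> x)) (power_kernel p q)) (\<lambda>x. ennreal (rescale \<epsilon> \<phi> x))"

definition energy :: "('a::euclidean_space \<Rightarrow> ennreal) \<Rightarrow> 'a measure \<Rightarrow> ennreal" where
  "energy W \<mu> = (\<integral>\<^sup>+y. (\<integral>\<^sup>+x. W (x - y) \<partial>\<mu>) \<partial>\<mu>)"

end

theory Submission
  imports Defs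
begin

text \<open>
  Let \<open>Z\<close> and \<open>Z'\<close> be independent with density \<open>\<phi>\<close>, and let \<open>Q\<close> be the law of \<open>W = Z + Z'\<close>. The mollified
  kernel is an average of translates of the kernel \<open>K\<close>: its value at \<open>x\<close> is the expectation of
  \<open>K (x - \<epsilon> W)\<close> (\<open>kernel_eps_eq_smear\<close>). The theorem then follows from three facts, in the manner
  of \<open>\<Gamma>\<close>-convergence.

  Upper bound. For every \<open>\<kappa> > 1\<close> the mollified kernel is at most \<open>\<kappa> K\<close> plus an error that vanishes with
  \<open>\<epsilon>\<close> (\<open>smear_power_kernel_le\<close>). In the attractive part, \<open>|x - \<epsilon> w|^q\<close> exceeds \<open>\<kappa> |x|^q\<close> by at
  most a multiple of \<open>\<epsilon>^q |w|^q\<close>, and \<open>Q\<close> has a finite \<open>q\<close>-th moment. In the singular part, \<open>|x - \<epsilon> w|\<close> is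
  smaller than a fixed fraction of \<open>|x|\<close> only if \<open>|w|\<close> is at least of order \<open>|x| / \<epsilon>\<close>, where the density of \<open>W\<close>
  is small; since \<open>p > - d\<close>, the singularity is integrable, and the contribution of such \<open>w\<close> is of
  order \<open>|x|^p min 1 (\<epsilon> / |x|)\<close>. By dominated convergence the upper limit of the mollified energies
  of a fixed measure is at most its energy (\<open>energy_smear_limsup\<close>). The bound also shows that the
  minimal mollified energies stay bounded.

  Compactness. A minimizer \<open>\<mu>\<close> of the energy with a nonnegative kernel \<open>V\<close>, with minimal value \<open>I\<close>,
  is compared with its own normalized restriction to the complement of a set \<open>A\<close>. This yields that
  the potential \<open>y \<mapsto> \<integral> V (x - y) d\<mu>(x)\<close> has integral at most \<open>2 I \<mu>(A)\<close> over \<open>A\<close>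
  (\<open>minimizer_interaction_le\<close>). The mollified kernels tend to infinity at infinity uniformly in \<open>\<epsilon>\<close>,
  so at least half of the mass lies in one ball of fixed radius; far away from it the potential
  exceeds \<open>2 I\<close>, and there can be no mass there. Hence all minimizers are supported in balls of one common radius
  (\<open>minimizer_supported_in_ball\<close>), and after translation in one ball. A sequence of laws in a fixed
  ball has a subsequence that is realized by pointwise convergent, uniformly bounded random
  variables (\<open>skorohod_representation_bounded\<close>); these couplings make it converge in the Wasserstein
  distance.

  Lower bound. Since \<open>K\<close> is continuous with values in \<open>[0, \<infinity>]\<close>, Fatou's lemma along these random
  variables bounds the energy of the limit by the lower limit of the mollified energies of the
  minimizers (\<open>energy_le_liminf_energy_smear\<close>). Combining this with minimality and the upper bound
  for an arbitrary competitor, the limit minimizes the energy.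
\<close>

section \<open>Sequential compactness of laws on a bounded set\<close>

text \<open>
  The \<open>k\<close>-th digit is \<open>\<lfloor>2^(k+1) x\<rfloor> - 2 \<lfloor>2^k x\<rfloor>\<close>, so that the partial sums telescope to
  \<open>\<lfloor>2^n x\<rfloor> / 2^n\<close>.
\<close>
lemma binary_expansion:
  fixes x :: real
  assumes "0 \<le> x" "x < 1"
  shows "\<exists>a. (\<forall>k. a k \<in> {0, 1}) \<and> (\<lambda>k. a k / 2 ^ Suc k) sums x"
proof (intro exI conjI)
  define a :: "nat \<Rightarrow> real" where "a k = of_int (\<lfloor>2 ^ Suc k * x\<rfloor> - 2 * \<lfloor>2 ^ k * x\<rfloor>)" for k
  show "\<forall>k. a k \<in> {0, 1}"
  proof
    fix k
    have "\<lfloor>2 ^ Suc k * x\<rfloor> - 2 * \<lfloor>2 ^ k * x\<rfloor> \<in> {0, 1}"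
      unfolding power_Suc mult.assoc by (simp; linarith)
    then show "a k \<in> {0, 1}" unfolding a_def by auto
  qed
  have part: "(\<Sum>k<n. a k / 2 ^ Suc k) = of_int \<lfloor>2 ^ n * x\<rfloor> / 2 ^ n" for n
  proof (induction n)
    case 0
    have "\<lfloor>x\<rfloor> = 0" using assms by linarith
    then show ?case by simp
  qed (simp add: a_def field_simps)
  have "(\<lambda>n. of_int \<lfloor>2 ^ n * x\<rfloor> / 2 ^ n) \<longlonglongrightarrow> x"
  proof (rule tendsto_sandwich)
    show "\<forall>\<^sub>F n in sequentially. x - (1 / 2) ^ n \<le> of_int \<lfloor>2 ^ n * x\<rfloor> / 2 ^ n"
    proof (intro always_eventually allI)
      fix n :: nat
      have "2 ^ n * x - 1 \<le> of_int \<lfloor>2 ^ n * x\<rfloor>" by linarith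
      then have "(2 ^ n * x - 1) / 2 ^ n \<le> of_int \<lfloor>2 ^ n * x\<rfloor> / 2 ^ n"
        by (intro divide_right_mono) auto
      then show "x - (1 / 2) ^ n \<le> of_int \<lfloor>2 ^ n * x\<rfloor> / 2 ^ n"
        by (simp add: diff_divide_distrib power_one_over)
    qed
    show "\<forall>\<^sub>F n in sequentially. of_int \<lfloor>2 ^ n * x\<rfloor> / 2 ^ n \<le> x"
    proof (intro always_eventually allI)
      fix n :: nat
      have "of_int \<lfloor>2 ^ n * x\<rfloor> \<le> 2 ^ n * x" by linarith
      then show "of_int \<lfloor>2 ^ n * x\<rfloor> / 2 ^ n \<le> x" by (simp add: field_simps)
    qed
    have "(\<lambda>n. x - (1 / 2) ^ n) \<longlonglongrightarrow> x - 0"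
      by (intro tendsto_intros LIMSEQ_power_zero) auto
    then show "(\<lambda>n. x - (1 / 2) ^ n) \<longlonglongrightarrow> x" by simp
  qed simp
  then show "(\<lambda>k. a k / 2 ^ Suc k) sums x" unfolding sums_def part .
qed

text \<open>
  For a sequence of binary digits this is the point of the Cantor set with ternary digits \<open>2 * c j\<close>.
\<close>
definition cantor_sum :: "(nat \<Rightarrow> real) \<Rightarrow> real" where
  "cantor_sum c = (\<Sum>j. 2 * c j / 3 ^ Suc j)"

lemma
  assumes c: "\<And>j. c j \<in> {0, 1 :: real}"
  shows cantor_sum_nonneg: "0 \<le> cantor_sum c"
    and cantor_sum_le_1: "cantor_sum c \<le> 1"
    and cantor_sum_shift: "3 * cantor_sum c = 2 * c 0 + cantor_sum (\<lambda>j. c (Suc j))"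
proof -
  have s: "(\<lambda>j. 2 / 3 ^ Suc j :: real) sums 1"
    using sums_mult[OF geometric_sums[of "1/3 :: real"], of "2/3"]
    by (simp add: power_divide)
  have b: "0 \<le> 2 * c j / 3 ^ Suc j" "2 * c j / 3 ^ Suc j \<le> 2 / 3 ^ Suc j" for j
    using c[of j] by auto
  have sm: "summable (\<lambda>j. 2 * c j / 3 ^ Suc j)"
    by (rule summable_comparison_test'[OF sums_summable[OF s]]) (subst real_norm_def, subst abs_of_nonneg, (rule b)+)
  show "0 \<le> cantor_sum c" unfolding cantor_sum_def by (intro suminf_nonneg sm b)
  have "cantor_sum c \<le> (\<Sum>j. 2 / 3 ^ Suc j)"
    unfolding cantor_sum_def by (intro suminf_le b sm sums_summable[OF s])
  then show "cantor_sum c \<le> 1" using sums_unique[OF s] by simp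
  have "cantor_sum c = 2 * c 0 / 3 + (\<Sum>j. 2 * c (Suc j) / 3 ^ Suc (Suc j))"
    unfolding cantor_sum_def using suminf_split_head[OF sm] by simp
  also have "(\<Sum>j. 2 * c (Suc j) / 3 ^ Suc (Suc j)) = (\<Sum>j. (2 * c (Suc j) / 3 ^ Suc j) / 3)"
    by (simp add: field_simps)
  also have "\<dots> = cantor_sum (\<lambda>j. c (Suc j)) / 3"
  proof -
    have "summable (\<lambda>j. 2 * c (Suc j) / 3 ^ Suc j)"
      using summable_mult[OF summable_Suc_iff[THEN iffD2, OF sm], of 3] by (simp add: field_simps)
    then show ?thesis unfolding cantor_sum_def by (rule suminf_divide)
  qed
  finally show "3 * cantor_sum c = 2 * c 0 + cantor_sum (\<lambda>j. c (Suc j))" by simp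
qed

text \<open>
  A continuous even function of period 2 that is 0 on \<open>[0, 1/3]\<close> and 1 on \<open>[2/3, 1]\<close>. It reads the
  first ternary digit of a point of the Cantor set, and after multiplication of the point by a
  power of 3 any later digit.
\<close>
definition bump :: "real \<Rightarrow> real" where
  "bump t = max 0 (min 1 (1 / 2 - cos (pi * t)))"

lemma bump_bounds: "0 \<le> bump t" "bump t \<le> 1" by (auto simp: bump_def)

lemma continuous_bump: "continuous_on A bump"
  unfolding bump_def by (intro continuous_intros)

lemma bump_periodic: "bump (2 * real N + t) = bump t"
proof -
  have "cos (pi * (2 * real N + t)) = cos (pi * t + 2 * pi * real N)" by (simp add: algebra_simps)
  also have "\<dots> = cos (pi * t)"
    unfolding cos_add using cos_2npi[of N] sin_2npi[of N] by (simp add: mult_ac)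
  finally show ?thesis unfolding bump_def by simp
qed

lemma bump_left: "0 \<le> t \<Longrightarrow> t \<le> 1 / 3 \<Longrightarrow> bump t = 0"
proof -
  assume t: "0 \<le> t" "t \<le> 1 / 3"
  have "cos (pi * (1 / 3)) \<le> cos (pi * t)"
    using t by (intro cos_monotone_0_pi_le) auto
  then show ?thesis using cos_60 by (simp add: bump_def)
qed

lemma bump_right: "2 / 3 \<le> t \<Longrightarrow> t \<le> 1 \<Longrightarrow> bump t = 1"
proof -
  assume t: "2 / 3 \<le> t" "t \<le> 1"
  have "cos (pi * t) \<le> cos (pi * (2 / 3))"
    using t by (intro cos_monotone_0_pi_le) auto
  also have "\<dots> = - cos (pi * (1 / 3))"
    using cos_pi_minus[of "pi * (1/3)"] by (simp add: field_simps)
  finally show ?thesis using cos_60 by (simp add: bump_def)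
qed

text \<open>
  Multiplication by \<open>3 ^ m\<close> shifts the digits: up to an even integer, which the period of \<^const>\<open>bump\<close>
  absorbs, the product is the point with digits \<open>c m, c (m + 1), \<dots>\<close>.
\<close>
lemma bump_cantor_sum:
  assumes c: "\<And>j. c j \<in> {0, 1 :: real}"
  shows "bump (3 ^ m * cantor_sum c) = c m"
proof -
  have "\<exists>N. 3 ^ m * cantor_sum c = 2 * real N + cantor_sum (\<lambda>j. c (m + j))"
  proof (induction m)
    case 0
    show ?case by (auto intro!: exI[of _ 0])
  next
    case (Suc m)
    then obtain N where N: "3 ^ m * cantor_sum c = 2 * real N + cantor_sum (\<lambda>j. c (m + j))" by auto
    have "3 * cantor_sum (\<lambda>j. c (m + j)) = 2 * c m + cantor_sum (\<lambda>j. c (Suc m + j))"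
      using cantor_sum_shift[of "\<lambda>j. c (m + j)"] c by simp
    moreover obtain b :: nat where "c m = real b" using c[of m] by (metis insertE of_nat_0 of_nat_1 singletonD)
    ultimately have "3 ^ Suc m * cantor_sum c = 2 * real (3 * N + b) + cantor_sum (\<lambda>j. c (Suc m + j))"
      using N by simp
    then show ?case by blast
  qed
  then obtain N where N: "3 ^ m * cantor_sum c = 2 * real N + cantor_sum (\<lambda>j. c (m + j))" by auto
  define s where "s = cantor_sum (\<lambda>j. c (m + j))"
  have "3 * s = 2 * c m + cantor_sum (\<lambda>j. c (Suc m + j))"
    using cantor_sum_shift[of "\<lambda>j. c (m + j)"] c by (simp add: s_def)
  moreover have "0 \<le> cantor_sum (\<lambda>j. c (Suc m + j))" "cantor_sum (\<lambda>j. c (Suc m + j)) \<le> 1"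
    using c by (auto intro!: cantor_sum_nonneg cantor_sum_le_1)
  ultimately have "bump s = c m"
    using c[of m] bump_left[of s] bump_right[of s] by auto
  then show ?thesis using bump_periodic[of N s] N by (simp add: s_def)
qed

text \<open>
  Schoenberg's space-filling curve: a point of the Cantor set encodes the binary digits of all
  coordinates at once, the \<open>k\<close>-th digit of coordinate \<open>i\<close> sitting at position \<open>to_nat (i, k)\<close>. It
  reduces compactness of laws on a cube to compactness of laws on the line.
\<close>
definition schoenberg :: "real \<Rightarrow> real ^ 'n" where
  "schoenberg t = (\<chi> i. \<Sum>k. bump (3 ^ to_nat (i, k) * t) / 2 ^ Suc k)"

lemma half_powers_sums: "(\<lambda>k. 1 / 2 ^ Suc k :: real) sums 1"
  using sums_mult[OF geometric_sums[of "1/2 :: real"], of "1/2"] by (simp add: power_divide)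

lemma continuous_schoenberg: "continuous_on UNIV (schoenberg :: real \<Rightarrow> real ^ 'n)"
proof -
  have "continuous_on UNIV (\<lambda>t. \<Sum>k. bump (3 ^ to_nat (i, k) * t) / 2 ^ Suc k)" for i :: 'n
  proof (rule uniform_limit_theorem)
    show "uniform_limit UNIV (\<lambda>n t. \<Sum>k<n. bump (3 ^ to_nat (i, k) * t) / 2 ^ Suc k)
        (\<lambda>t. \<Sum>k. bump (3 ^ to_nat (i, k) * t) / 2 ^ Suc k) sequentially"
      by (rule Weierstrass_m_test[OF _ sums_summable[OF half_powers_sums]])
        (auto simp: abs_of_nonneg bump_bounds intro!: divide_right_mono)
    show "\<forall>\<^sub>F n in sequentially. continuous_on UNIV (\<lambda>t. \<Sum>k<n. bump (3 ^ to_nat (i, k) * t) / 2 ^ Suc k)"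
      by (intro always_eventually allI continuous_intros
            continuous_on_compose2[OF continuous_bump[of UNIV]]) auto
  qed simp
  then show ?thesis unfolding schoenberg_def by (intro continuous_on_vec_lambda)
qed

lemma schoenberg_bounds: "0 \<le> schoenberg t $ i" "schoenberg t $ i \<le> 1"
proof -
  have sm: "summable (\<lambda>k. bump (3 ^ to_nat (i, k) * t) / 2 ^ Suc k)"
    by (rule summable_comparison_test'[OF sums_summable[OF half_powers_sums]])
      (auto simp: abs_of_nonneg bump_bounds intro!: divide_right_mono)
  show "0 \<le> schoenberg t $ i"
    unfolding schoenberg_def vec_lambda_beta by (intro suminf_nonneg sm) (simp add: bump_bounds)
  have "schoenberg t $ i \<le> (\<Sum>k. 1 / 2 ^ Suc k)"
    unfolding schoenberg_def vec_lambda_beta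
    by (intro suminf_le sm sums_summable[OF half_powers_sums] divide_right_mono bump_bounds) simp
  then show "schoenberg t $ i \<le> 1" using sums_unique[OF half_powers_sums] by simp
qed

lemma schoenberg_onto:
  fixes x :: "real ^ 'n"
  assumes "\<And>i. 0 \<le> x $ i" "\<And>i. x $ i < 1"
  shows "x \<in> schoenberg ` {0..1}"
proof -
  have "\<forall>i. \<exists>a. (\<forall>k. a k \<in> {0, 1}) \<and> (\<lambda>k. a k / 2 ^ Suc k) sums (x $ i)"
    using assms by (intro allI binary_expansion)
  from choice[OF this] obtain a :: "'n \<Rightarrow> nat \<Rightarrow> real"
    where a': "\<forall>i. (\<forall>k. a i k \<in> {0, 1}) \<and> (\<lambda>k. a i k / 2 ^ Suc k) sums (x $ i)" ..
  have a: "a i k \<in> {0, 1}" "(\<lambda>k. a i k / 2 ^ Suc k) sums (x $ i)" for i k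
    using a' by blast+
  define c where "c m = case_prod a (from_nat m)" for m
  have c: "c m \<in> {0, 1}" for m
    unfolding c_def case_prod_beta by (rule a(1))
  have c_eq: "c (to_nat (i, k)) = a i k" for i k
    unfolding c_def by simp
  have "schoenberg (cantor_sum c) $ i = x $ i" for i
    unfolding schoenberg_def vec_lambda_beta bump_cantor_sum[OF c] c_eq
    by (rule sums_unique[OF a(2), symmetric])
  then have "schoenberg (cantor_sum c) = x" by (simp add: vec_eq_iff)
  then show ?thesis
    using cantor_sum_nonneg[of c, OF c] cantor_sum_le_1[of c, OF c]
    by (intro image_eqI[of _ _ "cantor_sum c"]) auto
qed

text \<open>
  The first time \<open>S x\<close> at which the curve visits \<open>x\<close> is Borel, since \<open>S x \<le> a\<close> holds on the curve exactly
  for \<open>x\<close> in the compact image of \<open>{0..a}\<close>.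
\<close>
lemma borel_right_inverse:
  fixes T :: "real \<Rightarrow> 'a :: t2_space"
  assumes cont: "continuous_on UNIV T"
  shows "\<exists>S \<in> borel_measurable borel. \<forall>x. S x \<in> {0..1} \<and> (x \<in> T ` {0..1} \<longrightarrow> T (S x) = x)"
proof -
  define S where "S x = (if x \<in> T ` {0..1} then Inf {t \<in> {0..1}. T t = x} else 0)" for x
  have cl: "compact (T ` {0..a})" for a
    by (intro compact_continuous_image continuous_on_subset[OF cont]) auto
  have S: "S x \<in> {t \<in> {0..1}. T t = x}" "\<And>t. t \<in> {0..1} \<Longrightarrow> T t = x \<Longrightarrow> S x \<le> t"
    if "x \<in> T ` {0..1}" for x
  proof -
    have "closed (T -` {x})"
      using cont by (intro closed_vimage) auto
    then have "closed ({0..1} \<inter> T -` {x})" by (intro closed_Int) auto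
    moreover have "{0..1} \<inter> T -` {x} = {t \<in> {0..1}. T t = x}" by auto
    ultimately have "closed {t \<in> {0..1}. T t = x}" by simp
    moreover have "{t \<in> {0..1}. T t = x} \<noteq> {}" using that by auto
    moreover have "bdd_below {t \<in> {0..1}. T t = x}" by (auto intro!: bdd_belowI[of _ 0])
    ultimately have "Inf {t \<in> {0..1}. T t = x} \<in> {t \<in> {0..1}. T t = x}"
      by (intro closed_contains_Inf)
    then show "S x \<in> {t \<in> {0..1}. T t = x}"
      unfolding S_def using that by simp
    show "\<And>t. t \<in> {0..1} \<Longrightarrow> T t = x \<Longrightarrow> S x \<le> t"
      unfolding S_def using that by (auto intro!: cInf_lower bdd_belowI[of _ 0])
  qed
  have "S \<in> borel_measurable borel"
    unfolding borel_measurable_iff_le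
  proof
    fix a :: real
    have "{x. S x \<le> a} = T ` {0..min a 1} \<union> (if 0 \<le> a then - (T ` {0..1}) else {})"
    proof (intro set_eqI iffI)
      fix x assume x: "x \<in> {x. S x \<le> a}"
      show "x \<in> T ` {0..min a 1} \<union> (if 0 \<le> a then - (T ` {0..1}) else {})"
      proof (cases "x \<in> T ` {0..1}")
        case True
        have "S x \<in> {0..min a 1}" "x = T (S x)" using S(1)[OF True] x by auto
        then have "x \<in> T ` {0..min a 1}" by blast
        then show ?thesis by blast
      next
        case False
        then have "0 \<le> a" using x by (simp add: S_def)
        then show ?thesis using False by simp
      qed
    next
      fix x assume "x \<in> T ` {0..min a 1} \<union> (if 0 \<le> a then - (T ` {0..1}) else {})"
      then have x: "x \<in> T ` {0..min a 1} \<or> 0 \<le> a \<and> x \<notin> T ` {0..1}"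
        by (cases "0 \<le> a") (simp, simp)
      then show "x \<in> {x. S x \<le> a}"
      proof (elim disjE imageE conjE)
        fix t assume "x = T t" "t \<in> {0..min a 1}"
        note 1 = this
        then have "t \<in> {0..1}" by auto
        then have "S x \<le> t" using S(2)[of x t] 1 by blast
        then show ?thesis using 1 by simp
      next
        assume "0 \<le> a" "x \<notin> T ` {0..1}"
        then show ?thesis by (simp add: S_def)
      qed
    qed
    moreover have "T ` {0..min a 1} \<in> sets borel" "T ` {0..1} \<in> sets borel"
      using cl by (auto intro!: borel_closed compact_imp_closed)
    ultimately show "{x \<in> space borel. S x \<le> a} \<in> sets borel" by simp
  qed
  moreover have "S x \<in> {0..1}" for x
  proof (cases "x \<in> T ` {0..1}")
    case True
    then show ?thesis using S(1) by blast
  next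
    case False
    then show ?thesis by (simp add: S_def)
  qed
  ultimately show ?thesis using S(1) by blast
qed

lemma ball_parametrization:
  assumes "R > 0"
  shows "\<exists>T :: real \<Rightarrow> real ^ 'n. continuous_on UNIV T \<and> bounded (range T) \<and> cball 0 R \<subseteq> T ` {0..1}"
proof (intro exI conjI)
  define T :: "real \<Rightarrow> real ^ 'n" where "T t = (4 * R) *\<^sub>R schoenberg t - (\<chi> i. 2 * R)" for t
  show "continuous_on UNIV T"
    unfolding T_def by (intro continuous_intros continuous_schoenberg)
  have "norm (T t) \<le> real CARD('n) * (2 * R)" for t
  proof -
    have "norm (T t $ i) \<le> 2 * R" for i
    proof -
      have "0 \<le> (4 * R) * schoenberg t $ i" "(4 * R) * schoenberg t $ i \<le> (4 * R) * 1"
        using assms by (intro mult_nonneg_nonneg mult_left_mono schoenberg_bounds; simp)+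
      then show ?thesis by (simp add: T_def abs_le_iff)
    qed
    then have "(\<Sum>i\<in>UNIV. norm (T t $ i)) \<le> real CARD('n) * (2 * R)"
      using sum_bounded_above[of UNIV "\<lambda>i. norm (T t $ i)" "2 * R"] by simp
    then show ?thesis using norm_le_l1_cart[of "T t"] by simp
  qed
  then show "bounded (range T)" by (auto simp: bounded_iff)
  show "cball 0 R \<subseteq> T ` {0..1}"
  proof
    fix x :: "real ^ 'n" assume x: "x \<in> cball 0 R"
    define y :: "real ^ 'n" where "y = (1 / (4 * R)) *\<^sub>R (x + (\<chi> i. 2 * R))"
    have "\<bar>x $ i\<bar> \<le> R" for i using component_le_norm_cart[of x i] x by simp
    then have "- R \<le> x $ i" "x $ i \<le> R" for i by (auto simp: abs_le_iff minus_le_iff)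
    then have "0 \<le> y $ i" "y $ i < 1" for i
    proof -
      have "0 \<le> x $ i + 2 * R" "x $ i + 2 * R < 4 * R"
        using \<open>- R \<le> x $ i\<close> \<open>x $ i \<le> R\<close> assms by linarith+
      then show "0 \<le> y $ i" "y $ i < 1"
        using assms by (auto simp: y_def divide_simps)
    qed
    then obtain t where t: "t \<in> {0..1}" "y = schoenberg t" using schoenberg_onto[of y] by auto
    have "T t = x" using assms by (simp add: T_def t(2)[symmetric] y_def)
    then show "x \<in> T ` {0..1}" using t by blast
  qed
qed

text \<open>
  Prokhorov's and Skorohod's theorems on a bounded set, obtained from their one-dimensional
  versions: the laws are pulled back to \<open>[0, 1]\<close> by a Borel right inverse of a continuous curve that
  fills the ball, and continuity of the curve carries pointwise convergence back.
\<close>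
lemma skorohod_representation_bounded:
  fixes M :: "nat \<Rightarrow> (real ^ 'n) measure"
  assumes prob: "\<And>k. prob_space (M k)" and sets: "\<And>k. sets (M k) = sets borel"
    and bdd: "\<And>k. AE x in M k. norm x \<le> R"
  shows "\<exists>(r :: nat \<Rightarrow> nat) (\<Omega> :: real measure) Y Z B. strict_mono r \<and> prob_space \<Omega> \<and>
    (\<forall>k. Y k \<in> borel_measurable \<Omega>) \<and> Z \<in> borel_measurable \<Omega> \<and>
    (\<forall>k. distr \<Omega> borel (Y k) = M (r k)) \<and>
    (\<forall>\<omega>\<in>space \<Omega>. (\<lambda>k. Y k \<omega>) \<longlonglongrightarrow> Z \<omega>) \<and> (\<forall>\<omega> k. norm (Y k \<omega>) \<le> B) \<and> (\<forall>\<omega>. norm (Z \<omega>) \<le> B)"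
proof -
  have "max R 1 > 0" by simp
  then obtain T :: "real \<Rightarrow> real ^ 'n" where T: "continuous_on UNIV T" "bounded (range T)"
      "cball 0 (max R 1) \<subseteq> T ` {0..1}"
    using ball_parametrization by blast
  obtain S where S: "S \<in> borel_measurable borel" "\<And>x. S x \<in> {0..1}"
      "\<And>x. x \<in> T ` {0..1} \<Longrightarrow> T (S x) = x"
    using borel_right_inverse[OF T(1)] by auto
  obtain B where B: "\<And>t. norm (T t) \<le> B" using T(2) by (auto simp: bounded_iff)
  have mT [measurable]: "T \<in> borel_measurable borel"
    using T(1) by (rule borel_measurable_continuous_onI)
  note S(1) [measurable]
  have mS: "S \<in> borel_measurable (M k)" for k
    using S(1) sets[of k] by (simp cong: measurable_cong_sets)
  define \<rho> where "\<rho> k = distr (M k) borel S" for k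
  have rd: "real_distribution (\<rho> k)" for k
  proof -
    interpret prob_space "M k" by (rule prob)
    show ?thesis unfolding \<rho>_def by (rule real_distribution_distr[OF mS])
  qed
  have "tight \<rho>" unfolding tight_def
  proof (intro conjI allI impI rd)
    fix e :: real assume "e > 0"
    have "measure (\<rho> k) {-1<..1} = 1" for k
    proof -
      interpret prob_space "M k" by (rule prob)
      have "S -` {-1<..1} \<inter> space (M k) = space (M k)"
        using S(2) by (force simp: subset_eq)
      then show ?thesis unfolding \<rho>_def by (subst measure_distr[OF mS]) (auto simp: prob_space)
    qed
    then show "\<exists>a b. a < b \<and> (\<forall>n. 1 - e < measure (\<rho> n) {a<..b})"
      using \<open>e > 0\<close> by (intro exI[of _ "-1"] exI[of _ 1]) auto
  qed
  \<comment> \<open>The pulled-back laws live on \<open>[0, 1]\<close>, so Helly's and Skorohod's theorems on the line apply.\<close>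
  from tight_imp_convergent_subsubsequence[OF this strict_mono_id]
  obtain r N where r: "strict_mono r" "real_distribution N" "weak_conv_m (\<rho> \<circ> id \<circ> r) N"
    by blast
  from Skorohod[OF _ r(2,3)] rd obtain \<Omega> :: "real measure" and X X' where X: "prob_space \<Omega>"
     "\<And>k. X k \<in> borel_measurable \<Omega>" "\<And>k. distr \<Omega> borel (X k) = \<rho> (r k)"
     "X' \<in> \<Omega> \<rightarrow>\<^sub>M lborel" "\<forall>\<omega>\<in>space \<Omega>. (\<lambda>k. X k \<omega>) \<longlonglongrightarrow> X' \<omega>"
    by (auto simp: o_def)
  have X': "X' \<in> borel_measurable \<Omega>" using X(4) by (simp cong: measurable_cong_sets)
  note X(2) [measurable] X' [measurable]
  show ?thesis
  proof (intro exI conjI allI ballI)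
    show "strict_mono r" "prob_space \<Omega>" by fact+
    show "(\<lambda>\<omega>. T (X k \<omega>)) \<in> borel_measurable \<Omega>" for k by measurable
    show "(\<lambda>\<omega>. T (X' \<omega>)) \<in> borel_measurable \<Omega>" by measurable
    show "norm (T (X k \<omega>)) \<le> B" "norm (T (X' \<omega>)) \<le> B" for k \<omega> by (rule B)+
    show "(\<lambda>k. T (X k \<omega>)) \<longlonglongrightarrow> T (X' \<omega>)" if "\<omega> \<in> space \<Omega>" for \<omega>
      using T(1) X(5) that by (intro continuous_on_tendsto_compose[OF T(1)]) auto
    show "distr \<Omega> borel (\<lambda>\<omega>. T (X k \<omega>)) = M (r k)" for k
    proof -
      have "distr \<Omega> borel (\<lambda>\<omega>. T (X k \<omega>)) = distr (distr \<Omega> borel (X k)) borel T"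
        by (subst distr_distr) (auto simp: o_def)
      also have "\<dots> = distr (M (r k)) borel (\<lambda>x. T (S x))"
        unfolding X(3) \<rho>_def using mS by (subst distr_distr) (auto simp: o_def)
      also have "\<dots> = distr (M (r k)) borel (\<lambda>x. x)"
      proof (rule distr_cong_AE)
        have "T (S x) = x" if "norm x \<le> R" for x
          using that T(3) by (intro S(3)) (auto simp: subset_eq)
        then show "AE x in M (r k). T (S x) = x" using bdd[of "r k"] by auto
        show "(\<lambda>x. T (S x)) \<in> borel_measurable (M (r k))" using mS by measurable
        show "(\<lambda>x. x) \<in> borel_measurable (M (r k))" using sets by (simp cong: measurable_cong_sets)
      qed simp_all
      also have "\<dots> = M (r k)" using sets[of "r k"] by (intro distr_id2) simp
      finally show ?thesis .
    qed
  qed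
qed

section \<open>Integrals of powers of the norm\<close>

text \<open>
  The singular part of the kernel. The value at 0 is separate because \<open>0 powr p = 0\<close>.
\<close>
definition riesz :: "real \<Rightarrow> 'a::euclidean_space \<Rightarrow> ennreal" where
  "riesz p x = (if x = 0 then \<infinity> else ennreal (norm x powr p))"

lemma measurable_riesz [measurable]: "riesz p \<in> borel_measurable borel"
  unfolding riesz_def by measurable

lemma power_kernel_eq_riesz:
  assumes "p < 0" "0 < q"
  shows "power_kernel p q x = ennreal (norm x powr q / q) + ennreal (1 / - p) * riesz p x"
proof (cases "x = 0")
  case True
  have "ennreal (1 / - p) \<noteq> 0" using assms by (simp add: ennreal_eq_0_iff not_le divide_pos_neg)
  then show ?thesis using True by (simp add: power_kernel_def riesz_def ennreal_mult_top)
next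
  case False
  have "ennreal (1 / - p) * ennreal (norm x powr p) = ennreal (norm x powr p / - p)"
    using assms by (subst ennreal_mult[symmetric]) (auto simp: divide_nonneg_neg divide_le_0_iff)
  moreover have "ennreal (norm x powr q / q - norm x powr p / p) =
      ennreal (norm x powr q / q) + ennreal (norm x powr p / - p)"
    using assms by (subst ennreal_plus[symmetric]) (auto simp: divide_le_0_iff)
  ultimately show ?thesis using False by (simp add: power_kernel_def riesz_def)
qed

lemma measurable_power_kernel [measurable]: "power_kernel p q \<in> borel_measurable borel"
  unfolding power_kernel_def by measurable

lemma nn_integral_lborel_affine:
  fixes g :: "'a::euclidean_space \<Rightarrow> ennreal"
  assumes [measurable]: "g \<in> borel_measurable borel" and c: "c \<noteq> 0"
  shows "(\<integral>\<^sup>+w. g (t + c *\<^sub>R w) \<partial>lborel) * ennreal (\<bar>c\<bar> ^ DIM('a)) = (\<integral>\<^sup>+w. g w \<partial>lborel)"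
proof -
  have "(\<integral>\<^sup>+w. g w \<partial>lborel) =
      (\<integral>\<^sup>+w. ennreal (\<bar>c\<bar> ^ DIM('a)) * g w \<partial>distr lborel borel (\<lambda>x. t + c *\<^sub>R x))"
    by (subst lborel_affine[OF c, of t]) (subst nn_integral_density; simp)
  also have "\<dots> = (\<integral>\<^sup>+w. ennreal (\<bar>c\<bar> ^ DIM('a)) * g (t + c *\<^sub>R w) \<partial>lborel)"
    by (subst nn_integral_distr) auto
  also have "\<dots> = ennreal (\<bar>c\<bar> ^ DIM('a)) * (\<integral>\<^sup>+w. g (t + c *\<^sub>R w) \<partial>lborel)"
    by (rule nn_integral_cmult) simp
  finally show ?thesis by (simp add: mult.commute)
qed

lemma dyadic_shell_inside:
  fixes t r :: real
  assumes "0 < t" "t < r"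
  shows "\<exists>k. r / 2 ^ Suc k \<le> t \<and> t < r / 2 ^ k"
proof -
  obtain n where n: "r / t < 2 ^ n" using real_arch_pow[of 2 "r / t"] by auto
  then have ex: "\<exists>n. r / 2 ^ n \<le> t" using assms by (intro exI[of _ n]) (auto simp: field_simps)
  define m where "m = (LEAST n. r / 2 ^ n \<le> t)"
  have m: "r / 2 ^ m \<le> t" unfolding m_def by (rule LeastI_ex[OF ex])
  have "m \<noteq> 0" using m assms by (intro notI) simp
  then obtain k where k: "m = Suc k" by (cases m) auto
  have "\<not> r / 2 ^ k \<le> t"
    using not_less_Least[of k "\<lambda>n. r / 2 ^ n \<le> t"] k unfolding m_def by auto
  then show ?thesis using m k by auto
qed

lemma dyadic_shell_outside:
  fixes t :: real
  assumes "1 \<le> t"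
  shows "\<exists>k. 2 ^ k \<le> t \<and> t < 2 ^ Suc k"
proof -
  obtain k where k: "2 / 2 ^ Suc k \<le> 1 / t" "1 / t < 2 / 2 ^ k"
    using dyadic_shell_inside[of "1 / t" 2] assms by (auto simp: field_simps)
  show ?thesis
  proof (cases "t = 2 ^ k")
    case True
    then show ?thesis by (intro exI[of _ k]) auto
  next
    case False
    have "t < 2 ^ k" using k(1) assms False by (auto simp: field_simps)
    moreover have "2 ^ k < 2 * t" using k(2) assms by (auto simp: field_simps)
    moreover have "k \<noteq> 0" using \<open>t < 2 ^ k\<close> assms by (intro notI) simp
    ultimately show ?thesis by (intro exI[of _ "k - 1"]) (cases k, auto)
  qed
qed

text \<open>
  For functions dominated dyadic shell by dyadic shell, which gives both the integrability of
  powers near 0 and that near infinity.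
\<close>
lemma nn_integral_ball_series:
  fixes f :: "'a::euclidean_space \<Rightarrow> ennreal" and a s :: "nat \<Rightarrow> real"
  assumes f: "AE u in lborel. f u \<le> (\<Sum>k. ennreal (a k) * indicator (ball 0 (s k)) u)"
    and pos: "\<And>k. a k \<ge> 0" "\<And>k. s k \<ge> 0"
    and sums: "(\<lambda>k. a k * s k ^ DIM('a)) sums S"
  shows "(\<integral>\<^sup>+u. f u \<partial>lborel) \<le> ennreal (unit_ball_vol (real DIM('a)) * S)"
proof -
  have "(\<integral>\<^sup>+u. f u \<partial>lborel) \<le> (\<integral>\<^sup>+u. (\<Sum>k. ennreal (a k) * indicator (ball 0 (s k)) (u::'a)) \<partial>lborel)"
    by (rule nn_integral_mono_AE[OF f])
  also have "\<dots> = (\<Sum>k. ennreal (unit_ball_vol (real DIM('a)) * (a k * s k ^ DIM('a))))"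
  proof (subst nn_integral_suminf)
    show "(\<lambda>u::'a. ennreal (a k) * indicator (ball 0 (s k)) u) \<in> borel_measurable lborel" for k
      by (intro borel_measurable_times_ennreal borel_measurable_indicator) auto
    have "(\<integral>\<^sup>+u. ennreal (a k) * indicator (ball 0 (s k)) (u::'a) \<partial>lborel)
        = ennreal (unit_ball_vol (real DIM('a)) * (a k * s k ^ DIM('a)))" for k
      using pos by (subst nn_integral_cmult_indicator)
        (auto simp: emeasure_ball ennreal_mult[symmetric] mult_ac)
    then show "(\<Sum>k. \<integral>\<^sup>+u. ennreal (a k) * indicator (ball 0 (s k)) (u::'a) \<partial>lborel)
        = (\<Sum>k. ennreal (unit_ball_vol (real DIM('a)) * (a k * s k ^ DIM('a))))" by simp
  qed
  also have "\<dots> = ennreal (unit_ball_vol (real DIM('a)) * S)"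
    using pos sums by (intro suminf_ennreal_eq sums_mult) auto
  finally show ?thesis .
qed

lemma le_suminf_ennreal: "f k \<le> (\<Sum>k. f k :: ennreal)"
  using sum_le_suminf[of f "{k}"] by simp

text \<open>
  On the shell \<open>r / 2^(k+1) \<le> |u| < r / 2^k\<close> the function is at most \<open>(r / 2^(k+1))^p\<close>, and the volume of the
  shell is at most that of the ball of radius \<open>r / 2^k\<close>. The products form a geometric series with ratio
  \<open>2^(-(p+d))\<close>, which converges because \<open>p > - d\<close>.
\<close>
lemma riesz_integrable_on_ball:
  assumes p: "- real DIM('a) < p" "p < 0"
  shows "\<exists>c\<ge>0. \<forall>r>0. (\<integral>\<^sup>+u\<in>ball 0 r. riesz p (u::'a::euclidean_space) \<partial>lborel)
    \<le> ennreal (c * r powr (p + real DIM('a)))"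
proof (intro exI conjI allI impI)
  let ?d = "DIM('a)"
  define \<rho> where "\<rho> = 2 powr - (p + real ?d)"
  have \<rho>: "0 < \<rho>" "\<rho> < 1" using p by (auto simp: \<rho>_def powr_less_one)
  define c where "c = unit_ball_vol (real ?d) * (2 powr - p * (1 / (1 - \<rho>)))"
  show "0 \<le> c" using \<rho> by (simp add: c_def)
  fix r :: real assume r: "r > 0"
  define a where "a k = (r / 2 ^ Suc k) powr p" for k
  define s where "s k = r / 2 ^ k" for k
  have "(\<integral>\<^sup>+u. riesz p (u::'a) * indicator (ball 0 r) u \<partial>lborel)
      \<le> ennreal (unit_ball_vol (real ?d) * (r powr (p + real ?d) * 2 powr - p * (1 / (1 - \<rho>))))"
  proof (rule nn_integral_ball_series)
    show "AE u in lborel. riesz p (u::'a) * indicator (ball 0 r) u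
        \<le> (\<Sum>k. ennreal (a k) * indicator (ball 0 (s k)) u)"
    proof (rule AE_mp[OF AE_lborel_singleton[of 0] AE_I2], rule impI)
      fix u :: 'a assume "u \<noteq> 0"
      show "riesz p u * indicator (ball 0 r) u \<le> (\<Sum>k. ennreal (a k) * indicator (ball 0 (s k)) u)"
      proof (cases "norm u < r")
        case True
        then obtain k where k: "r / 2 ^ Suc k \<le> norm u" "norm u < r / 2 ^ k"
          using dyadic_shell_inside[of "norm u" r] \<open>u \<noteq> 0\<close> by auto
        have "norm u powr p \<le> a k"
          unfolding a_def using k(1) r p by (intro powr_mono2') auto
        then have "riesz p u * indicator (ball 0 r) u \<le> ennreal (a k) * indicator (ball 0 (s k)) u"
          using k(2) True \<open>u \<noteq> 0\<close> by (auto simp: riesz_def s_def intro!: ennreal_leI)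
        also have "\<dots> \<le> (\<Sum>k. ennreal (a k) * indicator (ball 0 (s k)) u)"
          by (rule le_suminf_ennreal)
        finally show ?thesis .
      qed simp
    qed
    show "0 \<le> a k" "0 \<le> s k" for k using r by (auto simp: a_def s_def)
    have "a k * s k ^ ?d = (r powr (p + real ?d) * 2 powr - p) * \<rho> ^ k" for k
    proof -
      have h: "2 ^ n = 2 powr real n" for n by (simp add: powr_realpow)
      have "a k = r powr p * 2 powr (- p * real (Suc k))"
      proof -
        have "r / 2 ^ Suc k = r * 2 powr - real (Suc k)"
          by (simp only: h powr_minus_divide) simp
        then show ?thesis unfolding a_def using r
          by (simp add: powr_mult powr_powr mult.commute del: of_nat_Suc)
      qed
      moreover have "s k ^ ?d = r powr real ?d * 2 powr (- (real k * real ?d))"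
      proof -
        have "s k = r * 2 powr - real k"
          unfolding s_def by (simp only: h powr_minus_divide) simp
        then have "s k ^ ?d = r ^ ?d * 2 powr (real ?d * - real k)"
          by (simp only: power_mult_distrib powr_power)
        then show ?thesis using r by (simp add: powr_realpow mult.commute)
      qed
      moreover have "\<rho> ^ k = 2 powr (- (p + real ?d) * real k)"
        unfolding \<rho>_def by (subst powr_power) (simp_all add: mult.commute)
      moreover have "2 powr (- p * real (Suc k)) * 2 powr (- (real k * real ?d))
          = 2 powr - p * 2 powr (- (p + real ?d) * real k)"
        unfolding powr_add[symmetric] by (rule arg_cong[of _ _ "(powr) 2"]) (simp add: algebra_simps)
      moreover have "r powr (p + real ?d) = r powr p * r powr real ?d" by (rule powr_add)
      ultimately show ?thesis by (simp only: mult.assoc mult.left_commute[of _ "r powr real ?d"])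
    qed
    then show "(\<lambda>k. a k * s k ^ ?d) sums (r powr (p + real ?d) * 2 powr - p * (1 / (1 - \<rho>)))"
      using sums_mult[OF geometric_sums[of \<rho>]] \<rho> by simp
  qed
  then show "(\<integral>\<^sup>+u\<in>ball 0 r. riesz p (u::'a) \<partial>lborel) \<le> ennreal (c * r powr (p + real ?d))"
    by (simp add: c_def mult_ac)
qed

text \<open>
  Shell by shell as before, now for \<open>2^k \<le> |u| < 2^(k+1)\<close>; the ratio is \<open>2^(d-m)\<close>.
\<close>
lemma power_integrable_outside_ball:
  assumes m: "real DIM('a) < m"
  shows "(\<integral>\<^sup>+u\<in>- ball 0 1. ennreal (norm (u::'a::euclidean_space) powr - m) \<partial>lborel) < \<infinity>"
proof -
  let ?d = "DIM('a)"
  define \<rho> where "\<rho> = 2 powr (real ?d - m)"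
  have \<rho>: "0 < \<rho>" "\<rho> < 1" using m by (auto simp: \<rho>_def powr_less_one)
  define a where "a k = (2 ^ k) powr - m" for k :: nat
  define s where "s k = (2 ^ Suc k :: real)" for k
  have "(\<integral>\<^sup>+u. ennreal (norm (u::'a) powr - m) * indicator (- ball 0 1) u \<partial>lborel)
      \<le> ennreal (unit_ball_vol (real ?d) * (2 ^ ?d * (1 / (1 - \<rho>))))"
  proof (rule nn_integral_ball_series)
    show "AE u in lborel. ennreal (norm (u::'a) powr - m) * indicator (- ball 0 1) u
        \<le> (\<Sum>k. ennreal (a k) * indicator (ball 0 (s k)) u)"
    proof (rule AE_I2)
      fix u :: 'a
      show "ennreal (norm u powr - m) * indicator (- ball 0 1) u \<le> (\<Sum>k. ennreal (a k) * indicator (ball 0 (s k)) u)"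
      proof (cases "1 \<le> norm u")
        case True
        then obtain k where k: "2 ^ k \<le> norm u" "norm u < 2 ^ Suc k"
          using dyadic_shell_outside[of "norm u"] by auto
        have "norm u powr - m \<le> a k"
          unfolding a_def using k(1) m by (intro powr_mono2') auto
        then have "ennreal (norm u powr - m) * indicator (- ball 0 1) u \<le> ennreal (a k) * indicator (ball 0 (s k)) u"
          using k(2) True by (auto simp: s_def intro!: ennreal_leI)
        also have "\<dots> \<le> (\<Sum>k. ennreal (a k) * indicator (ball 0 (s k)) u)"
          by (rule le_suminf_ennreal)
        finally show ?thesis .
      qed simp
    qed
    show "0 \<le> a k" "0 \<le> s k" for k by (auto simp: a_def s_def)
    have "a k * s k ^ ?d = 2 ^ ?d * \<rho> ^ k" for k
    proof -
      have "a k = 2 powr (- m * real k)" "s k ^ ?d = 2 ^ ?d * 2 powr (real ?d * real k)"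
        "\<rho> ^ k = 2 powr ((real ?d - m) * real k)"
      proof -
        have h: "2 ^ n = 2 powr real n" for n by (simp add: powr_realpow)
        show "a k = 2 powr (- m * real k)"
          by (simp only: a_def h powr_powr) (simp add: mult.commute)
        have "(2 ^ k :: real) ^ ?d = 2 powr (real ?d * real k)"
          by (simp only: h powr_power)
        then show "s k ^ ?d = 2 ^ ?d * 2 powr (real ?d * real k)"
          by (simp add: s_def power_mult_distrib)
        show "\<rho> ^ k = 2 powr ((real ?d - m) * real k)"
          unfolding \<rho>_def by (subst powr_power) (simp_all add: mult.commute)
      qed
      moreover have "- m * real k + real ?d * real k = (real ?d - m) * real k" by (simp add: algebra_simps)
      ultimately show ?thesis by (simp add: powr_add[symmetric] mult_ac)
    qed
    then show "(\<lambda>k. a k * s k ^ ?d) sums (2 ^ ?d * (1 / (1 - \<rho>)))"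
      using sums_mult[OF geometric_sums[of \<rho>]] \<rho> by simp
  qed
  then show ?thesis by (rule le_less_trans) simp
qed

section \<open>Mollification with a fast decaying law\<close>

text \<open>
  The measure is at most \<open>A * norm w powr - m\<close> times Lebesgue measure, in a form that mentions only
  integrals outside balls and therefore passes to convolutions without reference to densities.
\<close>
definition power_decay :: "real \<Rightarrow> 'a::euclidean_space measure \<Rightarrow> bool" where
  "power_decay m M \<longleftrightarrow> (\<exists>A\<ge>0. \<forall>f\<in>borel_measurable borel. \<forall>r>0.
     (\<integral>\<^sup>+w\<in>{w. r \<le> norm w}. f w \<partial>M) \<le> ennreal (A * r powr - m) * (\<integral>\<^sup>+w. f w \<partial>lborel))"

lemma power_decay_density:
  fixes \<phi> :: "'a::euclidean_space \<Rightarrow> real"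
  assumes [measurable]: "\<phi> \<in> borel_measurable borel"
    and m: "0 \<le> m" and bound: "\<And>w. w \<noteq> 0 \<Longrightarrow> \<phi> w \<le> A * norm w powr - m" and A: "A \<ge> 0"
  shows "power_decay m (density lborel \<phi>)"
  unfolding power_decay_def
proof (intro exI[of _ A] conjI A ballI allI impI)
  fix f :: "'a \<Rightarrow> ennreal" and r :: real
  assume [measurable]: "f \<in> borel_measurable borel" and r: "r > 0"
  have "(\<integral>\<^sup>+w. f w * indicator {w. r \<le> norm w} w \<partial>density lborel \<phi>)
      = (\<integral>\<^sup>+w. ennreal (\<phi> w) * (f w * indicator {w. r \<le> norm w} w) \<partial>lborel)"
    by (subst nn_integral_density) auto
  also have "\<dots> \<le> (\<integral>\<^sup>+w. ennreal (A * r powr - m) * f w \<partial>lborel)"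
  proof (rule nn_integral_mono)
    fix w :: 'a
    show "ennreal (\<phi> w) * (f w * indicator {w. r \<le> norm w} w) \<le> ennreal (A * r powr - m) * f w"
    proof (cases "r \<le> norm w")
      case True
      then have "\<phi> w \<le> A * norm w powr - m" using r by (intro bound) auto
      also have "\<dots> \<le> A * r powr - m"
        using True r m A by (intro mult_left_mono powr_mono2') auto
      finally show ?thesis using True by (auto intro!: mult_right_mono ennreal_leI)
    qed simp
  qed
  also have "\<dots> = ennreal (A * r powr - m) * (\<integral>\<^sup>+w. f w \<partial>lborel)"
    by (rule nn_integral_cmult) simp
  finally show "(\<integral>\<^sup>+w. f w * indicator {w. r \<le> norm w} w \<partial>density lborel \<phi>)
      \<le> ennreal (A * r powr - m) * (\<integral>\<^sup>+w. f w \<partial>lborel)" .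
qed

lemma nn_integral_lborel_shift:
  fixes f :: "'a::euclidean_space \<Rightarrow> ennreal"
  assumes "f \<in> borel_measurable borel"
  shows "(\<integral>\<^sup>+w. f (t + w) \<partial>lborel) = (\<integral>\<^sup>+w. f w \<partial>lborel)"
  using nn_integral_lborel_affine[OF assms, of 1 t] by simp

text \<open>
  If \<open>|z + w| \<ge> r\<close> then \<open>|z| \<ge> r / 2\<close> or \<open>|w| \<ge> r / 2\<close>, and in each case the decay in that variable and the
  translation invariance of Lebesgue measure give the bound.
\<close>
lemma power_decay_convolution:
  fixes M :: "'a::ordered_euclidean_space measure"
  assumes "prob_space M" and sets [measurable_cong]: "sets M = sets borel"
    and decay: "power_decay m M"
  shows "power_decay m (M \<star> M)"
proof -
  interpret prob_space M by fact
  interpret pair_sigma_finite M M ..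
  obtain A where A: "A \<ge> 0" and le: "\<And>f r. f \<in> borel_measurable borel \<Longrightarrow> r > 0 \<Longrightarrow>
      (\<integral>\<^sup>+w\<in>{w. r \<le> norm w}. f w \<partial>M) \<le> ennreal (A * r powr - m) * (\<integral>\<^sup>+w. f w \<partial>lborel)"
    using decay unfolding power_decay_def by blast
  show ?thesis unfolding power_decay_def
  proof (intro exI[of _ "2 * (A * (1 / 2) powr - m)"] conjI ballI allI impI)
    show "0 \<le> 2 * (A * (1 / 2) powr - m)" using A by simp
    fix f :: "'a \<Rightarrow> ennreal" and r :: real
    assume [measurable]: "f \<in> borel_measurable borel" and r: "r > 0"
    define c where "c = ennreal (A * (r / 2) powr - m)"
    define I where "I = (\<integral>\<^sup>+w. f w \<partial>lborel)"
    have one: "(\<integral>\<^sup>+w\<in>{w. r / 2 \<le> norm w}. f (z + w) \<partial>M) \<le> c * I" for z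
      using le[of "\<lambda>w. f (z + w)" "r / 2"] r nn_integral_lborel_shift[of f z]
      by (simp add: c_def I_def)
    have "(\<integral>\<^sup>+w\<in>{w. r \<le> norm w}. f w \<partial>(M \<star> M))
        = (\<integral>\<^sup>+z. \<integral>\<^sup>+w. f (z + w) * indicator {w. r \<le> norm w} (z + w) \<partial>M \<partial>M)"
      by (rule nn_integral_convolution) (auto simp: sets intro!: finite_measure_axioms)
    also have "\<dots> \<le> (\<integral>\<^sup>+z. \<integral>\<^sup>+w. (f (z + w) * indicator {w. r / 2 \<le> norm w} w
        + f (z + w) * indicator {w. r / 2 \<le> norm w} z) \<partial>M \<partial>M)"
    proof (intro nn_integral_mono)
      fix z w :: 'a
      have "r / 2 \<le> norm w \<or> r / 2 \<le> norm z" if "r \<le> norm (z + w)"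
        using that norm_triangle_ineq[of z w] by linarith
      then show "f (z + w) * indicator {w. r \<le> norm w} (z + w) \<le>
          f (z + w) * indicator {w. r / 2 \<le> norm w} w + f (z + w) * indicator {w. r / 2 \<le> norm w} z"
        by (auto simp: indicator_def)
    qed
    also have "\<dots> = (\<integral>\<^sup>+z. \<integral>\<^sup>+w. f (z + w) * indicator {w. r / 2 \<le> norm w} w \<partial>M \<partial>M)
        + (\<integral>\<^sup>+z. \<integral>\<^sup>+w. f (z + w) * indicator {w. r / 2 \<le> norm w} z \<partial>M \<partial>M)"
      by (simp add: nn_integral_add)
    also have "(\<integral>\<^sup>+z. \<integral>\<^sup>+w. f (z + w) * indicator {w. r / 2 \<le> norm w} z \<partial>M \<partial>M)
        = (\<integral>\<^sup>+w. \<integral>\<^sup>+z. f (z + w) * indicator {w. r / 2 \<le> norm w} z \<partial>M \<partial>M)"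
      by (rule Fubini'[symmetric]) measurable
    also have "\<dots> = (\<integral>\<^sup>+z. \<integral>\<^sup>+w. f (z + w) * indicator {w. r / 2 \<le> norm w} w \<partial>M \<partial>M)"
      by (simp add: add.commute)
    also have "(\<integral>\<^sup>+z. \<integral>\<^sup>+w. f (z + w) * indicator {w. r / 2 \<le> norm w} w \<partial>M \<partial>M) \<le> (\<integral>\<^sup>+z. c * I \<partial>M)"
      by (intro nn_integral_mono one)
    also have "\<dots> = c * I" by (simp add: emeasure_space_1)
    finally have "(\<integral>\<^sup>+w\<in>{w. r \<le> norm w}. f w \<partial>(M \<star> M)) \<le> c * I + c * I" by (simp add: add_mono)
    also have "c * I + c * I = ennreal (2 * (A * (1 / 2) powr - m) * r powr - m) * I"
    proof -
      have "c + c = ennreal (2 * (A * (r / 2) powr - m))"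
        unfolding c_def using A by (subst ennreal_plus[symmetric]) auto
      also have "(r / 2) powr - m = (1 / 2) powr - m * r powr - m"
        using r powr_mult[of "1/2" r "-m"] by simp
      finally show ?thesis by (simp add: distrib_right[symmetric] mult.assoc)
    qed
    finally show "(\<integral>\<^sup>+w\<in>{w. r \<le> norm w}. f w \<partial>(M \<star> M))
        \<le> ennreal (2 * (A * (1 / 2) powr - m) * r powr - m) * (\<integral>\<^sup>+w. f w \<partial>lborel)"
      by (simp add: I_def)
  qed
qed

text \<open>
  The expectation of \<open>W (x - \<epsilon> w)\<close> for \<open>w\<close> with law \<open>Q\<close>.
\<close>
definition smear :: "'a::euclidean_space measure \<Rightarrow> real \<Rightarrow> ('a \<Rightarrow> ennreal) \<Rightarrow> 'a \<Rightarrow> ennreal" where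
  "smear Q \<epsilon> W x = (\<integral>\<^sup>+w. W (x - \<epsilon> *\<^sub>R w) \<partial>Q)"

lemma nn_integral_rescale:
  fixes \<phi> :: "real ^ 'n \<Rightarrow> real" and g :: "real ^ 'n \<Rightarrow> ennreal"
  assumes [measurable]: "\<phi> \<in> borel_measurable borel" "g \<in> borel_measurable borel" and \<epsilon>: "\<epsilon> > 0"
    and nonneg: "\<And>x. 0 \<le> \<phi> x"
  shows "(\<integral>\<^sup>+z. g z * ennreal (rescale \<epsilon> \<phi> z) \<partial>lborel) = (\<integral>\<^sup>+z. g (\<epsilon> *\<^sub>R z) \<partial>density lborel \<phi>)"
proof -
  have [measurable]: "rescale \<epsilon> \<phi> \<in> borel_measurable borel" unfolding rescale_def by measurable
  have "(\<integral>\<^sup>+z. g z * ennreal (rescale \<epsilon> \<phi> z) \<partial>lborel)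
      = (\<integral>\<^sup>+z. g (\<epsilon> *\<^sub>R z) * ennreal (rescale \<epsilon> \<phi> (\<epsilon> *\<^sub>R z)) \<partial>lborel) * ennreal (\<epsilon> ^ CARD('n))"
    using nn_integral_lborel_affine[of "\<lambda>z. g z * ennreal (rescale \<epsilon> \<phi> z)" \<epsilon> 0] \<epsilon> by simp
  also have "\<dots> = (\<integral>\<^sup>+z. g (\<epsilon> *\<^sub>R z) * (ennreal (rescale \<epsilon> \<phi> (\<epsilon> *\<^sub>R z)) * ennreal (\<epsilon> ^ CARD('n))) \<partial>lborel)"
    by (subst nn_integral_multc[symmetric]) (auto simp: mult.assoc)
  also have "\<dots> = (\<integral>\<^sup>+z. ennreal (\<phi> z) * g (\<epsilon> *\<^sub>R z) \<partial>lborel)"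
    using \<epsilon> nonneg by (intro nn_integral_cong) (simp add: rescale_def ennreal_mult[symmetric] mult.commute)
  also have "\<dots> = (\<integral>\<^sup>+z. g (\<epsilon> *\<^sub>R z) \<partial>density lborel \<phi>)"
    by (subst nn_integral_density) auto
  finally show ?thesis .
qed

text \<open>
  Both convolutions are written as expectations over the unscaled mollifier by a change of
  variables.
\<close>
lemma kernel_eps_eq_smear:
  fixes \<phi> :: "real ^ 'n \<Rightarrow> real"
  assumes [measurable]: "\<phi> \<in> borel_measurable borel" and nonneg: "\<And>x. 0 \<le> \<phi> x"
    and prob: "prob_space (density lborel \<phi>)" and \<epsilon>: "\<epsilon> > 0"
  shows "kernel_eps p q \<phi> \<epsilon> = smear (density lborel \<phi> \<star> density lborel \<phi>) \<epsilon> (power_kernel p q)"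
proof
  fix x :: "real ^ 'n"
  let ?P = "density lborel \<phi>" and ?K = "power_kernel p q :: real ^ 'n \<Rightarrow> ennreal"
  interpret P: prob_space ?P by fact
  have [measurable]: "rescale \<epsilon> \<phi> \<in> borel_measurable borel" unfolding rescale_def by measurable
  have inner: "conv (\<lambda>x. ennreal (rescale \<epsilon> \<phi> x)) ?K v = (\<integral>\<^sup>+w. ?K (v - \<epsilon> *\<^sub>R w) \<partial>?P)" for v
  proof -
    have "conv (\<lambda>x. ennreal (rescale \<epsilon> \<phi> x)) ?K v
        = (\<integral>\<^sup>+y. ennreal (rescale \<epsilon> \<phi> (v - (v + (- 1) *\<^sub>R y))) * ?K (v + (- 1) *\<^sub>R y) \<partial>lborel)"
      unfolding conv_def
      using nn_integral_lborel_affine[of "\<lambda>y. ennreal (rescale \<epsilon> \<phi> (v - y)) * ?K y" "- 1" v] by simp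
    also have "\<dots> = (\<integral>\<^sup>+y. ?K (v - y) * ennreal (rescale \<epsilon> \<phi> y) \<partial>lborel)"
      by (simp add: mult.commute)
    also have "\<dots> = (\<integral>\<^sup>+w. ?K (v - \<epsilon> *\<^sub>R w) \<partial>?P)"
      by (rule nn_integral_rescale) (use \<epsilon> nonneg in auto)
    finally show ?thesis .
  qed
  have [measurable]: "(\<lambda>v. \<integral>\<^sup>+w. ?K (v - \<epsilon> *\<^sub>R w) \<partial>?P) \<in> borel_measurable borel"
    by measurable
  have "kernel_eps p q \<phi> \<epsilon> x
      = (\<integral>\<^sup>+z. (\<integral>\<^sup>+w. ?K (x - z - \<epsilon> *\<^sub>R w) \<partial>?P) * ennreal (rescale \<epsilon> \<phi> z) \<partial>lborel)"
    unfolding kernel_eps_def conv_def[of "conv _ _"] inner ..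
  also have "\<dots> = (\<integral>\<^sup>+z. \<integral>\<^sup>+w. ?K (x - \<epsilon> *\<^sub>R z - \<epsilon> *\<^sub>R w) \<partial>?P \<partial>?P)"
    by (rule nn_integral_rescale) (use \<epsilon> nonneg in auto)
  also have "\<dots> = smear (?P \<star> ?P) \<epsilon> ?K x"
    unfolding smear_def
    by (subst nn_integral_convolution) (auto simp: P.finite_measure_axioms algebra_simps)
  finally show "kernel_eps p q \<phi> \<epsilon> x = smear (?P \<star> ?P) \<epsilon> ?K x" .
qed

text \<open>
  Where \<open>|x - \<epsilon> w| \<ge> \<theta> |x|\<close> the integrand is at most \<open>(\<theta> |x|)^p\<close>. Elsewhere \<open>|w| \<ge> \<delta> |x| / \<epsilon>\<close> with \<open>\<delta> = 1 - \<theta>\<close>, so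
  decay of order \<open>m\<close> bounds the integral by a multiple of \<open>(|x| / \<epsilon>)^(-m)\<close> times the Lebesgue
  integral \<open>\<epsilon>^(-d) c |x|^(p+d)\<close>, that is by a multiple of \<open>|x|^p (\<epsilon> / |x|)^(m-d)\<close>. The order \<open>m = d\<close> makes the
  error comparable to \<open>|x|^p\<close>, which serves as dominating function, and \<open>m = d + 1\<close> makes it
  vanish as \<open>\<epsilon> \<longlongrightarrow> 0\<close>.
\<close>
lemma smear_riesz_le:
  fixes Q :: "'a::euclidean_space measure"
  assumes p: "- real DIM('a) < p" "p < 0"
    and Q: "prob_space Q" and [measurable_cong]: "sets Q = sets borel"
    and decay: "power_decay (real DIM('a)) Q" "power_decay (real DIM('a) + 1) Q"
    and \<theta>: "0 < \<theta>" "\<theta> < 1"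
  shows "\<exists>A\<ge>0. \<forall>\<epsilon>>0. \<forall>x. x \<noteq> 0 \<longrightarrow> smear Q \<epsilon> (riesz p) x
     \<le> ennreal ((\<theta> * norm x) powr p) + ennreal (A * (norm x powr p * min 1 (\<epsilon> / norm x)))"
proof -
  interpret prob_space Q by fact
  let ?d = "real DIM('a)"
  obtain c where c: "c \<ge> 0" "\<And>r. r > 0 \<Longrightarrow>
      (\<integral>\<^sup>+u\<in>ball 0 r. riesz p (u::'a) \<partial>lborel) \<le> ennreal (c * r powr (p + ?d))"
    using riesz_integrable_on_ball[OF p] by blast
  define \<delta> where "\<delta> = 1 - \<theta>"
  have \<delta>: "0 < \<delta>" using \<theta> by (simp add: \<delta>_def)
  \<comment> \<open>The bound for the far values of \<open>w\<close>, for any available order \<open>m\<close> of decay.\<close>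
  have key: "\<exists>A\<ge>0. \<forall>\<epsilon>>0. \<forall>x. x \<noteq> 0 \<longrightarrow>
      (\<integral>\<^sup>+w. riesz p (x - \<epsilon> *\<^sub>R w) * indicator (ball 0 (norm x)) (x - \<epsilon> *\<^sub>R w)
        * indicator {w. \<delta> * norm x / \<epsilon> \<le> norm w} w \<partial>Q)
      \<le> ennreal (A * (norm x powr p * (\<epsilon> / norm x) powr (m - ?d)))"
    if decay: "power_decay m Q" for m
  proof -
    obtain A where A: "A \<ge> 0" and le: "\<And>f r. f \<in> borel_measurable borel \<Longrightarrow> r > 0 \<Longrightarrow>
        (\<integral>\<^sup>+w\<in>{w. r \<le> norm w}. f w \<partial>Q) \<le> ennreal (A * r powr - m) * (\<integral>\<^sup>+w. f w \<partial>lborel)"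
      using decay unfolding power_decay_def by blast
    show ?thesis
    proof (intro exI[of _ "A * \<delta> powr - m * c"] conjI allI impI)
      show "0 \<le> A * \<delta> powr - m * c" using A c by simp
      fix \<epsilon> :: real and x :: 'a assume \<epsilon>: "\<epsilon> > 0" and x: "x \<noteq> 0"
      define r where "r = \<delta> * norm x / \<epsilon>"
      have r: "r > 0" using \<delta> \<epsilon> x by (simp add: r_def)
      define f where "f = (\<lambda>u::'a. riesz p u * indicator (ball 0 (norm x)) u)"
      have [measurable]: "ball 0 (norm x) \<in> sets (borel :: 'a measure)" by (rule borel_open) simp
      have [measurable]: "f \<in> borel_measurable borel" unfolding f_def by measurable
      have scale: "(\<integral>\<^sup>+w. f (x - \<epsilon> *\<^sub>R w) \<partial>lborel) * ennreal (\<epsilon> ^ DIM('a)) = (\<integral>\<^sup>+u. f u \<partial>lborel)"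
        using nn_integral_lborel_affine[of f "- \<epsilon>" x] \<epsilon> by simp
      have "ennreal (\<epsilon> ^ DIM('a)) * ennreal (1 / \<epsilon> ^ DIM('a)) = 1"
        using \<epsilon> by (subst ennreal_mult[symmetric]) auto
      then have "(\<integral>\<^sup>+w. f (x - \<epsilon> *\<^sub>R w) \<partial>lborel)
          = (\<integral>\<^sup>+w. f (x - \<epsilon> *\<^sub>R w) \<partial>lborel) * ennreal (\<epsilon> ^ DIM('a)) * ennreal (1 / \<epsilon> ^ DIM('a))"
        by (simp only: mult.assoc mult_1_right)
      also have "\<dots> = (\<integral>\<^sup>+u. f u \<partial>lborel) * ennreal (1 / \<epsilon> ^ DIM('a))"
        by (simp only: scale)
      also have "\<dots> \<le> ennreal (c * norm x powr (p + ?d)) * ennreal (1 / \<epsilon> ^ DIM('a))"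
        using c(2)[of "norm x"] x by (intro mult_right_mono) (auto simp: f_def)
      also have "\<dots> = ennreal (c * norm x powr (p + ?d) * \<epsilon> powr - ?d)"
        using c \<epsilon> by (subst ennreal_mult[symmetric]) (auto simp: powr_realpow powr_minus_divide)
      finally have int: "(\<integral>\<^sup>+w. f (x - \<epsilon> *\<^sub>R w) \<partial>lborel) \<le> ennreal (c * norm x powr (p + ?d) * \<epsilon> powr - ?d)" .
      have "(\<integral>\<^sup>+w. f (x - \<epsilon> *\<^sub>R w) * indicator {w. r \<le> norm w} w \<partial>Q)
          \<le> ennreal (A * r powr - m) * (\<integral>\<^sup>+w. f (x - \<epsilon> *\<^sub>R w) \<partial>lborel)"
        by (rule le[OF _ r]) measurable
      also have "\<dots> \<le> ennreal (A * r powr - m) * ennreal (c * norm x powr (p + ?d) * \<epsilon> powr - ?d)"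
        by (intro mult_left_mono int) simp
      also have "\<dots> = ennreal (A * r powr - m * (c * norm x powr (p + ?d) * \<epsilon> powr - ?d))"
        using A c by (subst ennreal_mult[symmetric]) auto
      also have "A * r powr - m * (c * norm x powr (p + ?d) * \<epsilon> powr - ?d)
          = A * \<delta> powr - m * c * (norm x powr p * (\<epsilon> / norm x) powr (m - ?d))"
      proof -
        have "r powr - m = \<delta> powr - m * norm x powr - m * \<epsilon> powr m"
        proof -
          have "r powr - m = (\<delta> * norm x) powr - m / \<epsilon> powr - m"
            unfolding r_def by (rule powr_divide)
          then show ?thesis using \<delta> \<epsilon> by (simp add: powr_mult powr_minus field_simps)
        qed
        moreover have "(\<epsilon> / norm x) powr (m - ?d) = \<epsilon> powr m * \<epsilon> powr - ?d * (norm x powr - m * norm x powr ?d)"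
          using \<epsilon> x by (simp add: powr_divide powr_diff powr_minus field_simps)
        moreover have "norm x powr (p + ?d) = norm x powr p * norm x powr ?d" by (rule powr_add)
        ultimately show ?thesis by (simp only: mult_ac)
      qed
      finally show "(\<integral>\<^sup>+w. riesz p (x - \<epsilon> *\<^sub>R w) * indicator (ball 0 (norm x)) (x - \<epsilon> *\<^sub>R w)
          * indicator {w. \<delta> * norm x / \<epsilon> \<le> norm w} w \<partial>Q)
        \<le> ennreal (A * \<delta> powr - m * c * (norm x powr p * (\<epsilon> / norm x) powr (m - ?d)))"
        by (simp add: f_def r_def)
    qed
  qed
  obtain A where A: "A \<ge> 0" "\<And>\<epsilon> x. \<epsilon> > 0 \<Longrightarrow> x \<noteq> 0 \<Longrightarrow>
      (\<integral>\<^sup>+w. riesz p (x - \<epsilon> *\<^sub>R w) * indicator (ball 0 (norm x)) (x - \<epsilon> *\<^sub>R w)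
        * indicator {w. \<delta> * norm x / \<epsilon> \<le> norm w} w \<partial>Q)
      \<le> ennreal (A * (norm x powr p * (\<epsilon> / norm x) powr (?d - ?d)))"
    using key[OF decay(1)] by blast
  obtain B where B: "B \<ge> 0" "\<And>\<epsilon> x. \<epsilon> > 0 \<Longrightarrow> x \<noteq> 0 \<Longrightarrow>
      (\<integral>\<^sup>+w. riesz p (x - \<epsilon> *\<^sub>R w) * indicator (ball 0 (norm x)) (x - \<epsilon> *\<^sub>R w)
        * indicator {w. \<delta> * norm x / \<epsilon> \<le> norm w} w \<partial>Q)
      \<le> ennreal (B * (norm x powr p * (\<epsilon> / norm x) powr (?d + 1 - ?d)))"
    using key[OF decay(2)] by blast
  show ?thesis
  proof (intro exI[of _ "max A B"] conjI allI impI)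
    show "0 \<le> max A B" using A by simp
    fix \<epsilon> :: real and x :: 'a assume \<epsilon>: "\<epsilon> > 0" and x: "x \<noteq> 0"
    have [measurable]: "ball 0 (norm x) \<in> sets (borel :: 'a measure)" by (rule borel_open) simp
    define J where "J = (\<integral>\<^sup>+w. riesz p (x - \<epsilon> *\<^sub>R w) * indicator (ball 0 (norm x)) (x - \<epsilon> *\<^sub>R w)
        * indicator {w. \<delta> * norm x / \<epsilon> \<le> norm w} w \<partial>Q)"
    have "smear Q \<epsilon> (riesz p) x \<le> (\<integral>\<^sup>+w. ennreal ((\<theta> * norm x) powr p)
        + riesz p (x - \<epsilon> *\<^sub>R w) * indicator (ball 0 (norm x)) (x - \<epsilon> *\<^sub>R w)
        * indicator {w. \<delta> * norm x / \<epsilon> \<le> norm w} w \<partial>Q)"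
      unfolding smear_def
    proof (rule nn_integral_mono)
      fix w :: 'a
      show "riesz p (x - \<epsilon> *\<^sub>R w) \<le> ennreal ((\<theta> * norm x) powr p)
        + riesz p (x - \<epsilon> *\<^sub>R w) * indicator (ball 0 (norm x)) (x - \<epsilon> *\<^sub>R w)
        * indicator {w. \<delta> * norm x / \<epsilon> \<le> norm w} w"
      proof (cases "\<theta> * norm x \<le> norm (x - \<epsilon> *\<^sub>R w)")
        case True
        have "x - \<epsilon> *\<^sub>R w \<noteq> 0"
        proof
          assume "x - \<epsilon> *\<^sub>R w = 0"
          then show False using True \<theta> x by (simp add: mult_le_0_iff)
        qed
        moreover have "norm (x - \<epsilon> *\<^sub>R w) powr p \<le> (\<theta> * norm x) powr p"
          using True \<theta> x p by (intro powr_mono2') auto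
        ultimately have "riesz p (x - \<epsilon> *\<^sub>R w) \<le> ennreal ((\<theta> * norm x) powr p)"
          by (simp add: riesz_def ennreal_leI)
        then show ?thesis by (rule add_increasing2[rotated]) simp
      next
        case False
        have "norm x \<le> norm (x - \<epsilon> *\<^sub>R w) + \<epsilon> * norm w"
          using norm_triangle_ineq[of "x - \<epsilon> *\<^sub>R w" "\<epsilon> *\<^sub>R w"] \<epsilon> by simp
        then have "\<delta> * norm x \<le> \<epsilon> * norm w"
          using False by (simp add: \<delta>_def algebra_simps)
        then have "\<delta> * norm x / \<epsilon> \<le> norm w" using \<epsilon> by (simp add: field_simps)
        moreover have "\<theta> * norm x \<le> 1 * norm x" using \<theta> by (intro mult_right_mono) auto
        ultimately show ?thesis using False by (simp add: indicator_def)
      qed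
    qed
    also have "(\<integral>\<^sup>+w. ennreal ((\<theta> * norm x) powr p)
        + riesz p (x - \<epsilon> *\<^sub>R w) * indicator (ball 0 (norm x)) (x - \<epsilon> *\<^sub>R w)
        * indicator {w. \<delta> * norm x / \<epsilon> \<le> norm w} w \<partial>Q) = ennreal ((\<theta> * norm x) powr p) + J"
      unfolding J_def by (subst nn_integral_add) (auto simp: emeasure_space_1)
    also have "J \<le> ennreal (max A B * (norm x powr p * min 1 (\<epsilon> / norm x)))"
    proof (cases "\<epsilon> / norm x \<le> 1")
      case True
      have "J \<le> ennreal (B * (norm x powr p * (\<epsilon> / norm x)))"
        using B(2)[OF \<epsilon> x] \<epsilon> x by (simp add: J_def)
      also have "\<dots> \<le> ennreal (max A B * (norm x powr p * (\<epsilon> / norm x)))"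
        using \<epsilon> by (intro ennreal_leI mult_right_mono) auto
      finally show ?thesis unfolding min_absorb2[OF True] .
    next
      case False
      have "J \<le> ennreal (A * (norm x powr p * 1))"
        using A(2)[OF \<epsilon> x] \<epsilon> x by (simp add: J_def)
      also have "\<dots> \<le> ennreal (max A B * (norm x powr p * 1))"
        by (intro ennreal_leI mult_right_mono) auto
      finally have "J \<le> ennreal (max A B * (norm x powr p * 1))" .
      moreover have "min 1 (\<epsilon> / norm x) = 1" using False by simp
      ultimately show ?thesis by simp
    qed
    finally show "smear Q \<epsilon> (riesz p) x
       \<le> ennreal ((\<theta> * norm x) powr p) + ennreal (max A B * (norm x powr p * min 1 (\<epsilon> / norm x)))"
      by (simp add: add_left_mono)
  qed
qed

text \<open>
  The factor of the main term \<open>a powr q\<close> is arbitrarily close to 1, at the price of a large factor of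
  the perturbation \<open>b powr q\<close>.
\<close>
lemma powr_sum_le:
  fixes a b q \<delta> :: real
  assumes "0 \<le> a" "0 \<le> b" "0 < q" "0 < \<delta>"
  shows "(a + b) powr q \<le> (1 + \<delta>) powr q * a powr q + (1 + 1 / \<delta>) powr q * b powr q"
proof (cases "b \<le> \<delta> * a")
  case True
  have "(a + b) powr q \<le> ((1 + \<delta>) * a) powr q"
    using assms True by (intro powr_mono2) (auto simp: algebra_simps)
  also have "\<dots> = (1 + \<delta>) powr q * a powr q" using assms by (simp add: powr_mult)
  finally show ?thesis by (rule order_trans) simp
next
  case False
  have "(a + b) powr q \<le> ((1 + 1 / \<delta>) * b) powr q"
    using assms False by (intro powr_mono2) (auto simp: field_simps)
  also have "\<dots> = (1 + 1 / \<delta>) powr q * b powr q" using assms by (simp add: powr_mult)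
  finally show ?thesis by (rule order_trans) simp
qed

text \<open>
  On the unit ball continuity bounds the density, and there \<open>norm x powr - m \<ge> 1\<close>.
\<close>
lemma decaying_density_bound:
  fixes \<phi> :: "'a::euclidean_space \<Rightarrow> real"
  assumes cont: "continuous_on UNIV \<phi>" and "C > 0"
    and decay: "\<And>x. x \<noteq> 0 \<Longrightarrow> \<phi> x \<le> C * norm x powr - l"
    and m: "0 \<le> m" "m \<le> l"
  shows "\<exists>A\<ge>0. \<forall>x. x \<noteq> 0 \<longrightarrow> \<phi> x \<le> A * norm x powr - m"
proof -
  have "bounded (\<phi> ` cball 0 1)"
    by (intro compact_imp_bounded compact_continuous_image continuous_on_subset[OF cont]) auto
  then obtain M where "\<forall>x\<in>cball 0 1. \<bar>\<phi> x\<bar> \<le> M"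
    by (auto simp: bounded_iff)
  then have M: "\<bar>\<phi> x\<bar> \<le> M" if "norm x \<le> 1" for x using that by simp
  show ?thesis
  proof (intro exI[of _ "max M C"] conjI allI impI)
    show "0 \<le> max M C" using \<open>C > 0\<close> by simp
    fix x :: 'a assume "x \<noteq> 0"
    show "\<phi> x \<le> max M C * norm x powr - m"
    proof (cases "norm x \<le> 1")
      case True
      have "1 powr - m \<le> norm x powr - m"
        using True \<open>x \<noteq> 0\<close> m by (intro powr_mono2') auto
      then have "max M C * 1 \<le> max M C * norm x powr - m"
        using \<open>C > 0\<close> by (intro mult_left_mono) auto
      then show ?thesis using M[OF True] by auto
    next
      case False
      have "\<phi> x \<le> C * norm x powr - l" by (rule decay) fact
      also have "\<dots> \<le> max M C * norm x powr - m"
        using False m \<open>C > 0\<close> by (intro mult_mono powr_mono) auto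
      finally show ?thesis .
    qed
  qed
qed

lemma density_moment_finite:
  fixes \<phi> :: "'a::euclidean_space \<Rightarrow> real"
  assumes [measurable]: "\<phi> \<in> borel_measurable borel" and "prob_space (density lborel \<phi>)"
    and "C > 0" and decay: "\<And>x. x \<noteq> 0 \<Longrightarrow> \<phi> x \<le> C * norm x powr - l"
    and q: "0 < q" "real DIM('a) + q < l"
  shows "(\<integral>\<^sup>+z. ennreal (norm z powr q) \<partial>density lborel \<phi>) < \<infinity>"
proof -
  interpret prob_space "density lborel \<phi>" by fact
  have [measurable]: "ball 0 1 \<in> sets (borel :: 'a measure)" by (rule borel_open) simp
  have one: "(\<integral>\<^sup>+z. ennreal (\<phi> z) \<partial>lborel) = 1"
    using emeasure_space_1 by (simp add: emeasure_density)
  have "(\<integral>\<^sup>+z. ennreal (norm z powr q) \<partial>density lborel \<phi>)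
      = (\<integral>\<^sup>+z. ennreal (\<phi> z) * ennreal (norm z powr q) \<partial>lborel)"
    by (subst nn_integral_density) auto
  also have "\<dots> \<le> (\<integral>\<^sup>+z. ennreal (\<phi> z) + ennreal C * (ennreal (norm z powr - (l - q)) * indicator (- ball 0 1) z) \<partial>lborel)"
  proof (rule nn_integral_mono)
    fix z :: 'a
    show "ennreal (\<phi> z) * ennreal (norm z powr q)
        \<le> ennreal (\<phi> z) + ennreal C * (ennreal (norm z powr - (l - q)) * indicator (- ball 0 1) z)"
    proof (cases "norm z < 1")
      case True
      then have "norm z powr q \<le> 1" using q by (intro powr_le1) auto
      then have "ennreal (\<phi> z) * ennreal (norm z powr q) \<le> ennreal (\<phi> z) * 1"
        by (intro mult_left_mono) (simp_all add: ennreal_le_1)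
      then show ?thesis by (rule order_trans) simp
    next
      case False
      then have "\<phi> z \<le> C * norm z powr - l" by (intro decay) auto
      then have "ennreal (\<phi> z) * ennreal (norm z powr q) \<le> ennreal (C * norm z powr - l) * ennreal (norm z powr q)"
        by (intro mult_right_mono ennreal_leI) auto
      also have "\<dots> = ennreal (C * (norm z powr - l * norm z powr q))"
        using \<open>C > 0\<close> by (subst ennreal_mult[symmetric]) (auto simp: mult.assoc)
      also have "norm z powr - l * norm z powr q = norm z powr - (l - q)"
        by (simp add: powr_add[symmetric])
      also have "ennreal (C * norm z powr - (l - q)) = ennreal C * ennreal (norm z powr - (l - q))"
        using \<open>C > 0\<close> by (intro ennreal_mult) auto
      finally show ?thesis using False by (auto intro: add_increasing)
    qed
  qed
  also have "\<dots> = 1 + ennreal C * (\<integral>\<^sup>+z\<in>- ball 0 1. ennreal (norm (z::'a) powr - (l - q)) \<partial>lborel)"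
    by (subst nn_integral_add) (auto simp: nn_integral_cmult one)
  also have "\<dots> < \<infinity>"
    using power_integrable_outside_ball[of "l - q", where 'a = 'a] q by (simp add: ennreal_mult_less_top)
  finally show ?thesis .
qed

lemma convolution_moment_finite:
  fixes M :: "'a::ordered_euclidean_space measure"
  assumes "prob_space M" and sets [measurable_cong]: "sets M = sets borel" and q: "0 < q"
    and fin: "(\<integral>\<^sup>+z. ennreal (norm z powr q) \<partial>M) < \<infinity>"
  shows "(\<integral>\<^sup>+z. ennreal (norm z powr q) \<partial>(M \<star> M)) < \<infinity>"
proof -
  interpret prob_space M by fact
  let ?I = "\<integral>\<^sup>+z. ennreal (norm z powr q) \<partial>M"
  have "(\<integral>\<^sup>+z. ennreal (norm z powr q) \<partial>(M \<star> M)) = (\<integral>\<^sup>+z. \<integral>\<^sup>+w. ennreal (norm (z + w) powr q) \<partial>M \<partial>M)"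
    by (rule nn_integral_convolution) (auto simp: sets finite_measure_axioms)
  also have "\<dots> \<le> (\<integral>\<^sup>+z. \<integral>\<^sup>+w. (ennreal (2 powr q) * ennreal (norm z powr q)
      + ennreal (2 powr q) * ennreal (norm w powr q)) \<partial>M \<partial>M)"
  proof (intro nn_integral_mono)
    fix z w :: 'a
    have "norm (z + w) powr q \<le> (norm z + norm w) powr q"
      using q by (intro powr_mono2 norm_triangle_ineq) auto
    also have "\<dots> \<le> 2 powr q * norm z powr q + 2 powr q * norm w powr q"
      using powr_sum_le[of "norm z" "norm w" q 1] q by simp
    finally show "ennreal (norm (z + w) powr q)
        \<le> ennreal (2 powr q) * ennreal (norm z powr q) + ennreal (2 powr q) * ennreal (norm w powr q)"
      by (simp add: ennreal_mult[symmetric] ennreal_plus[symmetric] ennreal_leI del: ennreal_plus)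
  qed
  also have "\<dots> = ennreal (2 powr q) * ?I + ennreal (2 powr q) * ?I"
    by (simp add: nn_integral_add nn_integral_cmult emeasure_space_1)
  also have "\<dots> < \<infinity>" using fin by (simp add: ennreal_mult_less_top)
  finally show ?thesis .
qed

lemma prob_space_convolution:
  fixes M :: "'a::ordered_euclidean_space measure"
  assumes "prob_space M" and [measurable_cong]: "sets M = sets borel"
  shows "prob_space (M \<star> M)"
proof -
  interpret prob_space M by fact
  interpret pair_prob_space M M ..
  show ?thesis unfolding convolution_def by (rule prob_space_distr) measurable
qed

section \<open>Upper bounds for mollified energies\<close>

lemma measurable_smear:
  assumes "prob_space Q" and [measurable_cong]: "sets Q = sets borel"
    and [measurable]: "W \<in> borel_measurable borel"
  shows "smear Q \<epsilon> W \<in> borel_measurable borel"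
proof -
  interpret prob_space Q by fact
  show ?thesis unfolding smear_def by measurable
qed

text \<open>
  The constants \<open>\<theta>\<close> and \<open>\<delta>\<close> of the bounds for the two parts are chosen so that both leading factors
  equal \<open>\<kappa>\<close>. At 0 the bound is trivial, since the kernel is infinite there.
\<close>
lemma smear_power_kernel_le:
  fixes Q :: "'a::euclidean_space measure"
  assumes p: "- real DIM('a) < p" "p < 0" and q: "0 < q"
    and Q: "prob_space Q" and sets [measurable_cong]: "sets Q = sets borel"
    and decay: "power_decay (real DIM('a)) Q" "power_decay (real DIM('a) + 1) Q"
    and moment: "(\<integral>\<^sup>+w. ennreal (norm w powr q) \<partial>Q) < \<infinity>"
    and \<kappa>: "1 < \<kappa>"
  shows "\<exists>A\<ge>0. \<forall>\<epsilon>>0. \<forall>x. smear Q \<epsilon> (power_kernel p q) x \<le> ennreal \<kappa> * power_kernel p q x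
     + ennreal (A * (norm x powr p * min 1 (\<epsilon> / norm x))) + ennreal (A * \<epsilon> powr q)"
proof -
  interpret prob_space Q by fact
  define \<theta> where "\<theta> = \<kappa> powr (1 / p)"
  have \<theta>: "0 < \<theta>" "\<theta> < 1" using \<kappa> p by (auto simp: \<theta>_def powr_less_one)
  have \<theta>p: "\<theta> powr p = \<kappa>" using \<kappa> p by (simp add: \<theta>_def powr_powr)
  define \<delta> where "\<delta> = \<kappa> powr (1 / q) - 1"
  have \<delta>: "0 < \<delta>" using \<kappa> q by (simp add: \<delta>_def gr_one_powr)
  have \<delta>q: "(1 + \<delta>) powr q = \<kappa>" using \<kappa> q by (simp add: \<delta>_def powr_powr)
  obtain A where A: "A \<ge> 0" "\<And>\<epsilon> x. \<epsilon> > 0 \<Longrightarrow> x \<noteq> 0 \<Longrightarrow> smear Q \<epsilon> (riesz p) x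
     \<le> ennreal ((\<theta> * norm x) powr p) + ennreal (A * (norm x powr p * min 1 (\<epsilon> / norm x)))"
    using smear_riesz_le[OF p Q sets decay \<theta>] by blast
  obtain M where M: "M \<ge> 0" "(\<integral>\<^sup>+w. ennreal (norm w powr q) \<partial>Q) = ennreal M"
    using moment by (cases "\<integral>\<^sup>+w. ennreal (norm w powr q) \<partial>Q" rule: ennreal_cases) auto
  define B where "B = (1 + 1 / \<delta>) powr q * M / q"
  have B: "B \<ge> 0" using M q by (simp add: B_def)
  show ?thesis
  proof (intro exI[of _ "max (A / - p) B"] conjI allI impI)
    show "0 \<le> max (A / - p) B" using B by simp
    fix \<epsilon> :: real and x :: 'a assume \<epsilon>: "\<epsilon> > 0"
    define h where "h = norm x powr p * min 1 (\<epsilon> / norm x)"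
    have h: "h \<ge> 0" using \<epsilon> by (simp add: h_def)
    show "smear Q \<epsilon> (power_kernel p q) x \<le> ennreal \<kappa> * power_kernel p q x
        + ennreal (max (A / - p) B * (norm x powr p * min 1 (\<epsilon> / norm x)))
        + ennreal (max (A / - p) B * \<epsilon> powr q)"
    proof (cases "x = 0")
      case True
      then show ?thesis using \<kappa> by (simp add: power_kernel_def ennreal_mult_top)
    next
      case False
      have "smear Q \<epsilon> (power_kernel p q) x
          = (\<integral>\<^sup>+w. ennreal (norm (x - \<epsilon> *\<^sub>R w) powr q / q) \<partial>Q) + ennreal (1 / - p) * smear Q \<epsilon> (riesz p) x"
        unfolding smear_def power_kernel_eq_riesz[OF p(2) q]
        by (subst nn_integral_add) (auto simp: nn_integral_cmult)
      also have "(\<integral>\<^sup>+w. ennreal (norm (x - \<epsilon> *\<^sub>R w) powr q / q) \<partial>Q)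
          \<le> ennreal (\<kappa> * norm x powr q / q) + ennreal (B * \<epsilon> powr q)"
      proof -
        let ?b = "(1 + 1 / \<delta>) powr q * \<epsilon> powr q / q"
        have "(\<integral>\<^sup>+w. ennreal (norm (x - \<epsilon> *\<^sub>R w) powr q / q) \<partial>Q)
            \<le> (\<integral>\<^sup>+w. ennreal (\<kappa> * norm x powr q / q) + ennreal ?b * ennreal (norm w powr q) \<partial>Q)"
        proof (rule nn_integral_mono)
          fix w
          have "norm (x - \<epsilon> *\<^sub>R w) powr q \<le> (norm x + \<epsilon> * norm w) powr q"
            using norm_triangle_ineq4[of x "\<epsilon> *\<^sub>R w"] \<epsilon> q by (intro powr_mono2) auto
          also have "\<dots> \<le> (1 + \<delta>) powr q * norm x powr q + (1 + 1 / \<delta>) powr q * (\<epsilon> * norm w) powr q"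
            using \<epsilon> q \<delta> by (intro powr_sum_le) auto
          also have "\<dots> = \<kappa> * norm x powr q + (1 + 1 / \<delta>) powr q * \<epsilon> powr q * norm w powr q"
            using \<epsilon> by (simp add: \<delta>q powr_mult)
          finally have "norm (x - \<epsilon> *\<^sub>R w) powr q / q
              \<le> (\<kappa> * norm x powr q + (1 + 1 / \<delta>) powr q * \<epsilon> powr q * norm w powr q) / q"
            using q by (intro divide_right_mono) auto
          also have "\<dots> = \<kappa> * norm x powr q / q + ?b * norm w powr q"
            by (simp add: add_divide_distrib)
          finally have "ennreal (norm (x - \<epsilon> *\<^sub>R w) powr q / q)
              \<le> ennreal (\<kappa> * norm x powr q / q + ?b * norm w powr q)" by (rule ennreal_leI)
          also have "\<dots> = ennreal (\<kappa> * norm x powr q / q) + ennreal ?b * ennreal (norm w powr q)"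
            using q \<kappa> by (subst ennreal_mult[symmetric]) (auto intro!: ennreal_plus)
          finally show "ennreal (norm (x - \<epsilon> *\<^sub>R w) powr q / q)
              \<le> ennreal (\<kappa> * norm x powr q / q) + ennreal ?b * ennreal (norm w powr q)" .
        qed
        also have "\<dots> = ennreal (\<kappa> * norm x powr q / q) + ennreal ?b * ennreal M"
          by (subst nn_integral_add) (auto simp: nn_integral_cmult M emeasure_space_1)
        also have "ennreal ?b * ennreal M = ennreal (B * \<epsilon> powr q)"
          using M q by (subst ennreal_mult[symmetric]) (auto simp: B_def field_simps)
        finally show ?thesis .
      qed
      also have "ennreal (1 / - p) * smear Q \<epsilon> (riesz p) x
          \<le> ennreal (\<kappa> * norm x powr p / - p) + ennreal (A / - p * h)"
      proof -
        have "smear Q \<epsilon> (riesz p) x \<le> ennreal ((\<theta> * norm x) powr p) + ennreal (A * h)"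
          using A(2)[OF \<epsilon> False] by (simp add: h_def)
        also have "(\<theta> * norm x) powr p = \<kappa> * norm x powr p"
          using \<theta> by (simp add: powr_mult \<theta>p)
        also have "ennreal (\<kappa> * norm x powr p) + ennreal (A * h) = ennreal (\<kappa> * norm x powr p + A * h)"
          using \<kappa> A h by (intro ennreal_plus[symmetric]) auto
        finally have "ennreal (1 / - p) * smear Q \<epsilon> (riesz p) x
            \<le> ennreal (1 / - p) * ennreal (\<kappa> * norm x powr p + A * h)" by (rule mult_left_mono) simp
        also have "\<dots> = ennreal (1 / - p * (\<kappa> * norm x powr p + A * h))"
          using \<kappa> A h p by (intro ennreal_mult[symmetric]) (auto simp: divide_le_0_iff)
        also have "1 / - p * (\<kappa> * norm x powr p + A * h) = \<kappa> * norm x powr p / - p + A / - p * h"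
          using p by (simp add: field_simps)
        also have "ennreal \<dots> = ennreal (\<kappa> * norm x powr p / - p) + ennreal (A / - p * h)"
          using \<kappa> A h p by (intro ennreal_plus) (auto simp: divide_le_0_iff mult_le_0_iff)
        finally show ?thesis .
      qed
      also have "ennreal (\<kappa> * norm x powr q / q) + ennreal (B * \<epsilon> powr q)
          + (ennreal (\<kappa> * norm x powr p / - p) + ennreal (A / - p * h))
          = (ennreal (\<kappa> * norm x powr q / q) + ennreal (\<kappa> * norm x powr p / - p))
          + ennreal (A / - p * h) + ennreal (B * \<epsilon> powr q)"
        by (simp add: ac_simps)
      also have "ennreal (\<kappa> * norm x powr q / q) + ennreal (\<kappa> * norm x powr p / - p)
          = ennreal (\<kappa> * norm x powr q / q + \<kappa> * norm x powr p / - p)"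
        using \<kappa> p q by (intro ennreal_plus[symmetric]) (auto simp: divide_le_0_iff)
      also have "\<kappa> * norm x powr q / q + \<kappa> * norm x powr p / - p
          = \<kappa> * (norm x powr q / q - norm x powr p / p)"
        using p q by (simp add: field_simps)
      also have "ennreal \<dots> = ennreal \<kappa> * power_kernel p q x"
      proof -
        have "0 \<le> norm x powr q / q" "norm x powr p / p \<le> 0"
          using p q by (auto simp: divide_le_0_iff)
        then have "0 \<le> norm x powr q / q - norm x powr p / p" by linarith
        then show ?thesis using False \<kappa> by (simp add: power_kernel_def ennreal_mult)
      qed
      also have "ennreal \<kappa> * power_kernel p q x + ennreal (A / - p * h) + ennreal (B * \<epsilon> powr q)
          \<le> ennreal \<kappa> * power_kernel p q x + ennreal (max (A / - p) B * h) + ennreal (max (A / - p) B * \<epsilon> powr q)"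
        using h by (intro add_mono order_refl ennreal_leI mult_right_mono) auto
      finally show ?thesis by (simp add: h_def add_mono)
    qed
  qed
qed

lemma energy_eq_nn_integral_pair:
  assumes "prob_space \<nu>" and [measurable_cong]: "sets \<nu> = sets borel"
    and [measurable]: "W \<in> borel_measurable borel"
  shows "energy W \<nu> = (\<integral>\<^sup>+z. W (snd z - fst z) \<partial>(\<nu> \<Otimes>\<^sub>M \<nu>))"
proof -
  interpret prob_space \<nu> by fact
  show ?thesis
    unfolding energy_def
    using nn_integral_fst[of "\<lambda>z. W (snd z - fst z)" \<nu>] by simp
qed

lemma energy_smear_le:
  fixes Q \<nu> :: "'a::euclidean_space measure"
  assumes p: "- real DIM('a) < p" "p < 0" and q: "0 < q"
    and Q: "prob_space Q" and sets: "sets Q = sets borel"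
    and decay: "power_decay (real DIM('a)) Q" "power_decay (real DIM('a) + 1) Q"
    and moment: "(\<integral>\<^sup>+w. ennreal (norm w powr q) \<partial>Q) < \<infinity>"
    and \<kappa>: "1 < \<kappa>"
    and \<nu>: "prob_space \<nu>" and sets_\<nu> [measurable_cong]: "sets \<nu> = sets borel"
  shows "\<exists>A\<ge>0. \<forall>\<epsilon>>0. energy (smear Q \<epsilon> (power_kernel p q)) \<nu> \<le> ennreal \<kappa> * energy (power_kernel p q) \<nu>
     + ennreal A * energy (\<lambda>x. ennreal (norm x powr p * min 1 (\<epsilon> / norm x))) \<nu> + ennreal (A * \<epsilon> powr q)"
proof -
  interpret \<nu>: prob_space \<nu> by fact
  interpret pair: pair_prob_space \<nu> \<nu> ..
  let ?K = "power_kernel p q :: 'a \<Rightarrow> ennreal"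
  obtain A where A: "A \<ge> 0" "\<And>\<epsilon> x. \<epsilon> > 0 \<Longrightarrow> smear Q \<epsilon> ?K x \<le> ennreal \<kappa> * ?K x
     + ennreal (A * (norm x powr p * min 1 (\<epsilon> / norm x))) + ennreal (A * \<epsilon> powr q)"
    using smear_power_kernel_le[OF p q Q sets decay moment \<kappa>] by blast
  show ?thesis
  proof (intro exI[of _ A] conjI A(1) allI impI)
    fix \<epsilon> :: real assume \<epsilon>: "\<epsilon> > 0"
    note [measurable] = measurable_smear[OF Q sets measurable_power_kernel]
    let ?h = "\<lambda>x::'a. norm x powr p * min 1 (\<epsilon> / norm x)"
    have "energy (smear Q \<epsilon> ?K) \<nu> = (\<integral>\<^sup>+z. smear Q \<epsilon> ?K (snd z - fst z) \<partial>(\<nu> \<Otimes>\<^sub>M \<nu>))"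
      by (intro energy_eq_nn_integral_pair \<nu> sets_\<nu>) measurable
    also have "\<dots> \<le> (\<integral>\<^sup>+z. ennreal \<kappa> * ?K (snd z - fst z)
        + ennreal A * ennreal (?h (snd z - fst z)) + ennreal (A * \<epsilon> powr q) \<partial>(\<nu> \<Otimes>\<^sub>M \<nu>))"
      using A \<epsilon> by (intro nn_integral_mono) (simp add: ennreal_mult[symmetric])
    also have "\<dots> = ennreal \<kappa> * (\<integral>\<^sup>+z. ?K (snd z - fst z) \<partial>(\<nu> \<Otimes>\<^sub>M \<nu>))
        + ennreal A * (\<integral>\<^sup>+z. ennreal (?h (snd z - fst z)) \<partial>(\<nu> \<Otimes>\<^sub>M \<nu>)) + ennreal (A * \<epsilon> powr q)"
      by (simp add: nn_integral_add nn_integral_cmult pair.emeasure_space_1)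
    also have "\<dots> = ennreal \<kappa> * energy ?K \<nu> + ennreal A * energy (\<lambda>x. ennreal (?h x)) \<nu> + ennreal (A * \<epsilon> powr q)"
      by (simp add: energy_eq_nn_integral_pair[OF \<nu> sets_\<nu>])
    finally show "energy (smear Q \<epsilon> ?K) \<nu> \<le> ennreal \<kappa> * energy ?K \<nu>
        + ennreal A * energy (\<lambda>x. ennreal (?h x)) \<nu> + ennreal (A * \<epsilon> powr q)" .
  qed
qed

lemma riesz_part_le_power_kernel:
  assumes p: "p < 0" and q: "0 < q"
  shows "ennreal (norm x powr p) \<le> ennreal (- p) * power_kernel p q x"
proof (cases "x = 0")
  case False
  have "0 \<le> norm x powr q / q" "norm x powr p / p \<le> 0"
    using p q by (auto simp: divide_le_0_iff)
  then have "ennreal (- p) * power_kernel p q x = ennreal (- p * (norm x powr q / q - norm x powr p / p))"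
    using False p by (simp only: power_kernel_def if_False) (intro ennreal_mult[symmetric], auto)
  moreover have "norm x powr p \<le> - p * (norm x powr q / q - norm x powr p / p)"
  proof -
    have "- p * (norm x powr q / q - norm x powr p / p) = - p * (norm x powr q / q) + norm x powr p"
      using p by (simp add: field_simps)
    moreover have "0 \<le> - p * (norm x powr q / q)" using p q by (intro mult_nonneg_nonneg) auto
    ultimately show ?thesis by linarith
  qed
  ultimately show ?thesis by (simp add: ennreal_leI)
qed (use p in simp)

lemma energy_riesz_part_finite:
  fixes \<nu> :: "'a::euclidean_space measure"
  assumes p: "p < 0" and q: "0 < q"
    and \<nu>: "prob_space \<nu>" and sets_\<nu> [measurable_cong]: "sets \<nu> = sets borel"
    and fin: "energy (power_kernel p q) \<nu> < \<infinity>"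
  shows "energy (\<lambda>x. ennreal (norm x powr p)) \<nu> < \<infinity>"
proof -
  interpret \<nu>: prob_space \<nu> by fact
  have "energy (\<lambda>x. ennreal (norm x powr p)) \<nu> \<le> (\<integral>\<^sup>+y. \<integral>\<^sup>+x. ennreal (- p) * power_kernel p q (x - y) \<partial>\<nu> \<partial>\<nu>)"
    unfolding energy_def by (intro nn_integral_mono riesz_part_le_power_kernel p q)
  also have "\<dots> = ennreal (- p) * energy (power_kernel p q) \<nu>"
    unfolding energy_def by (simp add: nn_integral_cmult)
  also have "\<dots> < \<infinity>" using fin by (simp add: ennreal_mult_less_top)
  finally show ?thesis .
qed

text \<open>
  The error kernel \<open>norm x powr p * min 1 (\<epsilon> / norm x)\<close> tends to 0 pointwise and is dominated by the
  repulsive part of the kernel, whose energy is finite.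
\<close>
lemma energy_smear_limsup:
  fixes Q \<nu> :: "'a::euclidean_space measure"
  assumes p: "- real DIM('a) < p" "p < 0" and q: "0 < q"
    and Q: "prob_space Q" and sets: "sets Q = sets borel"
    and decay: "power_decay (real DIM('a)) Q" "power_decay (real DIM('a) + 1) Q"
    and moment: "(\<integral>\<^sup>+w. ennreal (norm w powr q) \<partial>Q) < \<infinity>"
    and \<nu>: "prob_space \<nu>" and sets_\<nu> [measurable_cong]: "sets \<nu> = sets borel"
    and fin: "energy (power_kernel p q) \<nu> < \<infinity>"
    and \<epsilon>s: "\<epsilon>s \<longlonglongrightarrow> 0" "\<And>k. \<epsilon>s k > 0"
    and \<kappa>: "1 < \<kappa>"
  shows "limsup (\<lambda>k. energy (smear Q (\<epsilon>s k) (power_kernel p q)) \<nu>) \<le> ennreal \<kappa> * energy (power_kernel p q) \<nu>"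
proof -
  interpret \<nu>: prob_space \<nu> by fact
  let ?K = "power_kernel p q :: 'a \<Rightarrow> ennreal"
  let ?h = "\<lambda>\<epsilon> x::'a. norm x powr p * min 1 (\<epsilon> / norm x)"
  obtain A where A: "A \<ge> 0" "\<And>\<epsilon>. \<epsilon> > 0 \<Longrightarrow> energy (smear Q \<epsilon> ?K) \<nu> \<le> ennreal \<kappa> * energy ?K \<nu>
     + ennreal A * energy (\<lambda>x. ennreal (?h \<epsilon> x)) \<nu> + ennreal (A * \<epsilon> powr q)"
    using energy_smear_le[OF p q Q sets decay moment \<kappa> \<nu> sets_\<nu>] by blast
  have "(\<lambda>k. \<integral>\<^sup>+z. ennreal (?h (\<epsilon>s k) (snd z - fst z)) \<partial>(\<nu> \<Otimes>\<^sub>M \<nu>)) \<longlonglongrightarrow> (\<integral>\<^sup>+z. 0 \<partial>(\<nu> \<Otimes>\<^sub>M \<nu>))"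
  proof (rule nn_integral_dominated_convergence)
    show "(\<integral>\<^sup>+z. ennreal (norm (snd z - fst z) powr p) \<partial>(\<nu> \<Otimes>\<^sub>M \<nu>)) < \<infinity>"
      using energy_riesz_part_finite[OF p(2) q \<nu> sets_\<nu> fin] energy_eq_nn_integral_pair[OF \<nu> sets_\<nu>, of "\<lambda>x. ennreal (norm x powr p)"]
      by simp
    show "AE z in \<nu> \<Otimes>\<^sub>M \<nu>. ennreal (?h (\<epsilon>s k) (snd z - fst z)) \<le> ennreal (norm (snd z - fst z) powr p)" for k
      by (intro AE_I2 ennreal_leI mult_right_le_one_le) (auto intro!: divide_nonneg_nonneg less_imp_le[OF \<epsilon>s(2)])
    show "AE z in \<nu> \<Otimes>\<^sub>M \<nu>. (\<lambda>k. ennreal (?h (\<epsilon>s k) (snd z - fst z))) \<longlonglongrightarrow> 0"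
    proof (rule AE_I2)
      fix z :: "'a \<times> 'a"
      define v where "v = snd z - fst z"
      have "(\<lambda>k. norm v powr p * min 1 (\<epsilon>s k * inverse (norm v))) \<longlonglongrightarrow> norm v powr p * min 1 (0 * inverse (norm v))"
        by (intro tendsto_intros \<epsilon>s)
      then have "(\<lambda>k. ennreal (?h (\<epsilon>s k) v)) \<longlonglongrightarrow> ennreal 0"
        by (intro tendsto_ennrealI) (simp add: divide_inverse)
      then show "(\<lambda>k. ennreal (?h (\<epsilon>s k) (snd z - fst z))) \<longlonglongrightarrow> 0" by (simp add: v_def)
    qed
  qed measurable
  then have h0: "(\<lambda>k. energy (\<lambda>x. ennreal (?h (\<epsilon>s k) x)) \<nu>) \<longlonglongrightarrow> 0"
    by (simp add: energy_eq_nn_integral_pair[OF \<nu> sets_\<nu>])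
  have e0: "(\<lambda>k. ennreal (A * \<epsilon>s k powr q)) \<longlonglongrightarrow> ennreal (A * 0)"
  proof (intro tendsto_ennrealI tendsto_mult tendsto_const)
    have "(\<lambda>k. \<epsilon>s k powr q) \<longlonglongrightarrow> 0 powr q"
      using q \<epsilon>s by (intro tendsto_powr') (auto intro!: always_eventually less_imp_le)
    then show "(\<lambda>k. \<epsilon>s k powr q) \<longlonglongrightarrow> 0" using q by simp
  qed
  have "(\<lambda>k. ennreal \<kappa> * energy ?K \<nu> + ennreal A * energy (\<lambda>x. ennreal (?h (\<epsilon>s k) x)) \<nu> + ennreal (A * \<epsilon>s k powr q))
      \<longlonglongrightarrow> ennreal \<kappa> * energy ?K \<nu> + ennreal A * 0 + ennreal (A * 0)"
    by (intro tendsto_add tendsto_const tendsto_mult_ennreal h0 e0) auto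
  then have "limsup (\<lambda>k. ennreal \<kappa> * energy ?K \<nu> + ennreal A * energy (\<lambda>x. ennreal (?h (\<epsilon>s k) x)) \<nu> + ennreal (A * \<epsilon>s k powr q))
      = ennreal \<kappa> * energy ?K \<nu> + ennreal A * 0 + ennreal (A * 0)"
    by (intro lim_imp_Limsup) auto
  moreover have "limsup (\<lambda>k. energy (smear Q (\<epsilon>s k) ?K) \<nu>) \<le>
      limsup (\<lambda>k. ennreal \<kappa> * energy ?K \<nu> + ennreal A * energy (\<lambda>x. ennreal (?h (\<epsilon>s k) x)) \<nu> + ennreal (A * \<epsilon>s k powr q))"
    by (intro Limsup_mono always_eventually allI A(2) \<epsilon>s(2))
  ultimately show ?thesis by simp
qed

lemma energy_smear_bounded:
  fixes Q \<nu> :: "'a::euclidean_space measure"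
  assumes p: "- real DIM('a) < p" "p < 0" and q: "0 < q"
    and Q: "prob_space Q" and sets: "sets Q = sets borel"
    and decay: "power_decay (real DIM('a)) Q" "power_decay (real DIM('a) + 1) Q"
    and moment: "(\<integral>\<^sup>+w. ennreal (norm w powr q) \<partial>Q) < \<infinity>"
    and \<nu>: "prob_space \<nu>" and sets_\<nu> [measurable_cong]: "sets \<nu> = sets borel"
    and fin: "energy (power_kernel p q) \<nu> < \<infinity>"
  shows "\<exists>B\<ge>0. \<forall>\<epsilon>\<in>{0<..1}. energy (smear Q \<epsilon> (power_kernel p q)) \<nu> \<le> ennreal B"
proof -
  interpret \<nu>: prob_space \<nu> by fact
  let ?K = "power_kernel p q :: 'a \<Rightarrow> ennreal"
  obtain A where A: "A \<ge> 0" "\<And>\<epsilon>. \<epsilon> > 0 \<Longrightarrow> energy (smear Q \<epsilon> ?K) \<nu> \<le> ennreal 2 * energy ?K \<nu>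
     + ennreal A * energy (\<lambda>x. ennreal (norm x powr p * min 1 (\<epsilon> / norm x))) \<nu> + ennreal (A * \<epsilon> powr q)"
    using energy_smear_le[OF p q Q sets decay moment, of 2 \<nu>] \<nu> sets_\<nu> by auto
  define F where "F = ennreal 2 * energy ?K \<nu> + ennreal A * energy (\<lambda>x. ennreal (norm x powr p)) \<nu> + ennreal A"
  have "F < \<infinity>" using energy_riesz_part_finite[OF p(2) q \<nu> sets_\<nu> fin] fin
    unfolding F_def by (simp add: ennreal_mult_less_top)
  then obtain B where B: "B \<ge> 0" "F = ennreal B" by (cases F rule: ennreal_cases) auto
  have "energy (smear Q \<epsilon> ?K) \<nu> \<le> F" if \<epsilon>: "\<epsilon> \<in> {0<..1}" for \<epsilon>
  proof -
    have "energy (\<lambda>x. ennreal (norm x powr p * min 1 (\<epsilon> / norm x))) \<nu> \<le> energy (\<lambda>x. ennreal (norm x powr p)) \<nu>"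
      unfolding energy_def using \<epsilon>
      by (intro nn_integral_mono ennreal_leI mult_right_le_one_le) (auto intro!: divide_nonneg_nonneg)
    moreover have "A * \<epsilon> powr q \<le> A * 1"
      using \<epsilon> A q by (intro mult_left_mono powr_le1) auto
    ultimately have "ennreal 2 * energy ?K \<nu>
        + ennreal A * energy (\<lambda>x. ennreal (norm x powr p * min 1 (\<epsilon> / norm x))) \<nu> + ennreal (A * \<epsilon> powr q) \<le> F"
      unfolding F_def by (intro add_mono mult_left_mono ennreal_leI) auto
    then show ?thesis using A(2)[of \<epsilon>] \<epsilon> by (auto intro: order_trans)
  qed
  then show ?thesis using B by auto
qed

section \<open>Minimizers are supported in balls of a common radius\<close>

lemma P2_iff: "\<mu> \<in> P2 \<longleftrightarrow> prob_space \<mu> \<and> sets \<mu> = sets borel \<and> (\<integral>\<^sup>+x. ennreal ((norm x)\<^sup>2) \<partial>\<mu>) < \<infinity>"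
  by (simp add: P2_def)

lemma P2_if_bounded:
  assumes "prob_space \<mu>" "sets \<mu> = sets borel" "AE x in \<mu>. norm x \<le> R"
  shows "\<mu> \<in> P2"
proof -
  interpret prob_space \<mu> by fact
  have "(\<integral>\<^sup>+x. ennreal ((norm x)\<^sup>2) \<partial>\<mu>) \<le> (\<integral>\<^sup>+x. ennreal (R\<^sup>2) \<partial>\<mu>)"
    by (rule nn_integral_mono_AE, use assms(3) in eventually_elim) (auto intro!: ennreal_leI power_mono)
  also have "\<dots> < \<infinity>" by (simp add: emeasure_space_1)
  finally show ?thesis using assms by (simp add: P2_iff)
qed

text \<open>
  For the uniform law on the unit ball only differences in the ball of radius 2 occur, where the
  kernel is integrable.
\<close>
lemma uniform_ball_finite_energy:
  assumes p: "- real DIM('a) < p" "p < 0" and q: "0 < q"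
  shows "\<exists>\<nu> \<in> (P2 :: 'a::euclidean_space measure set). energy (power_kernel p q) \<nu> < \<infinity>"
proof -
  let ?U = "ball 0 1 :: 'a set" and ?K = "power_kernel p q :: 'a \<Rightarrow> ennreal"
  have [measurable]: "ball 0 r \<in> sets (borel :: 'a measure)" for r by (rule borel_open) simp
  define \<nu> where "\<nu> = uniform_measure lborel ?U"
  define v where "v = emeasure lborel ?U"
  have v: "v \<noteq> 0" "v \<noteq> \<infinity>"
    by (auto simp: v_def emeasure_ball ennreal_eq_0_iff not_le)
  have \<nu>: "prob_space \<nu>" unfolding \<nu>_def using v by (intro prob_space_uniform_measure) (auto simp: v_def)
  have sets: "sets \<nu> = sets borel" by (simp add: \<nu>_def)
  have AE: "AE x in \<nu>. x \<in> ?U"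
    unfolding \<nu>_def using v by (intro AE_uniform_measureI) (auto simp: v_def)
  interpret \<nu>: prob_space \<nu> by fact
  have "\<nu> \<in> P2"
  proof (rule P2_if_bounded[OF \<nu> sets, of 1])
    show "AE x in \<nu>. norm x \<le> 1" using AE by eventually_elim auto
  qed
  moreover have "energy ?K \<nu> < \<infinity>"
  proof -
    define F where "F = (\<integral>\<^sup>+u\<in>ball 0 2. ?K u \<partial>lborel)"
    obtain c where c: "(\<integral>\<^sup>+u\<in>ball 0 2. riesz p (u::'a) \<partial>lborel) \<le> ennreal (c * 2 powr (p + real DIM('a)))"
      using riesz_integrable_on_ball[OF p] by (metis zero_less_numeral)
    have "F \<le> (\<integral>\<^sup>+u. ennreal (2 powr q / q) * indicator (ball 0 2) (u::'a)
        + ennreal (1 / - p) * (riesz p u * indicator (ball 0 2) u) \<partial>lborel)"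
      unfolding F_def
    proof (rule nn_integral_mono)
      fix u :: 'a
      show "?K u * indicator (ball 0 2) u \<le> ennreal (2 powr q / q) * indicator (ball 0 2) u
        + ennreal (1 / - p) * (riesz p u * indicator (ball 0 2) u)"
      proof (cases "norm u < 2")
        case True
        then have "norm u powr q / q \<le> 2 powr q / q"
          using q by (intro divide_right_mono powr_mono2) auto
        then show ?thesis using True
          by (auto simp: power_kernel_eq_riesz[OF p(2) q] intro!: add_right_mono ennreal_leI)
      qed simp
    qed
    also have "\<dots> = ennreal (2 powr q / q) * emeasure lborel (ball (0::'a) 2)
        + ennreal (1 / - p) * (\<integral>\<^sup>+u\<in>ball 0 2. riesz p (u::'a) \<partial>lborel)"
      by (subst nn_integral_add) (auto simp: nn_integral_cmult nn_integral_cmult_indicator)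
    also have "\<dots> < \<infinity>"
      using c emeasure_lborel_ball_finite[of "0::'a" 2]
      by (auto simp: ennreal_mult_less_top intro: le_less_trans)
    finally have F: "F < \<infinity>" .
    have inner: "(\<integral>\<^sup>+x. ?K (x - y) \<partial>\<nu>) \<le> F / v" if "y \<in> ?U" for y
    proof -
      have "(\<integral>\<^sup>+x. ?K (x - y) \<partial>\<nu>) = (\<integral>\<^sup>+x\<in>?U. ?K (x - y) \<partial>lborel) / v"
        unfolding \<nu>_def v_def by (rule nn_integral_uniform_measure) auto
      also have "(\<integral>\<^sup>+x\<in>?U. ?K (x - y) \<partial>lborel) \<le> (\<integral>\<^sup>+x. ?K (- y + x) * indicator (ball 0 2) (- y + x) \<partial>lborel)"
      proof (rule nn_integral_mono)
        fix x :: 'a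
        have "norm (x - y) < 2" if "x \<in> ?U"
          using that \<open>y \<in> ?U\<close> norm_triangle_ineq4[of x y] by simp
        then show "?K (x - y) * indicator ?U x \<le> ?K (- y + x) * indicator (ball 0 2) (- y + x)"
          by (auto simp: indicator_def)
      qed
      also have "\<dots> = F"
        unfolding F_def by (rule nn_integral_lborel_shift[of "\<lambda>u. ?K u * indicator (ball 0 2) u"]) measurable
      finally show ?thesis by (simp add: divide_right_mono_ennreal)
    qed
    have "energy ?K \<nu> \<le> (\<integral>\<^sup>+y. F / v \<partial>\<nu>)"
      unfolding energy_def by (rule nn_integral_mono_AE, use AE in eventually_elim) (rule inner)
    also have "\<dots> < \<infinity>" using F v by (simp add: \<nu>.emeasure_space_1 ennreal_divide_eq_top_iff less_top[symmetric])
    finally show ?thesis .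
  qed
  ultimately show ?thesis by blast
qed

text \<open>
  At least half of the mass of \<open>Q\<close> lies in a ball of some radius \<open>M\<close>, and for these \<open>w\<close> the point \<open>x - \<epsilon> w\<close>
  has norm at least \<open>norm x - M\<close>, so that the attractive part alone is large.
\<close>
lemma smear_power_kernel_coercive:
  fixes Q :: "'a::euclidean_space measure"
  assumes p: "p < 0" and q: "0 < q" and "prob_space Q" and sets [measurable_cong]: "sets Q = sets borel"
  shows "\<exists>R>0. \<forall>\<epsilon>\<in>{0<..1}. \<forall>x. R \<le> norm x \<longrightarrow> ennreal T \<le> smear Q \<epsilon> (power_kernel p q) x"
proof -
  interpret prob_space Q by fact
  have "(\<lambda>n. measure Q (cball 0 (real n))) \<longlonglongrightarrow> measure Q (\<Union>n. cball 0 (real n))"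
    using sets by (intro finite_Lim_measure_incseq) (auto simp: incseq_def intro!: borel_closed)
  moreover have "(\<Union>n. cball (0::'a) (real n)) = space Q"
    using sets_eq_imp_space_eq[OF sets] by (auto intro: real_arch_simple)
  ultimately have "(\<lambda>n. measure Q (cball 0 (real n))) \<longlonglongrightarrow> 1" by (simp add: prob_space)
  then have "\<forall>\<^sub>F n in sequentially. 1 / 2 < measure Q (cball 0 (real n))"
    by (rule order_tendstoD) simp
  then obtain n where n: "1 / 2 < measure Q (cball 0 (real n))"
    by (auto simp: eventually_sequentially)
  define M where "M = real n"
  define T' where "T' = max T 1"
  define s where "s = (2 * q * T') powr (1 / q)"
  have s: "s > 0" "s powr q / q = 2 * T'" using q by (auto simp: s_def T'_def powr_powr)
  show ?thesis
  proof (intro exI[of _ "M + s"] conjI ballI allI impI)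
    show "M + s > 0" using s by (simp add: M_def)
    fix \<epsilon> :: real and x :: 'a assume \<epsilon>: "\<epsilon> \<in> {0<..1}" and x: "M + s \<le> norm x"
    have "ennreal T \<le> ennreal (2 * T' * (1 / 2))" by (intro ennreal_leI) (simp add: T'_def)
    also have "\<dots> \<le> ennreal (2 * T' * measure Q (cball 0 M))"
      using n by (intro ennreal_leI mult_left_mono) (auto simp: M_def T'_def)
    also have "\<dots> = (\<integral>\<^sup>+w. ennreal (2 * T') * indicator (cball 0 M) w \<partial>Q)"
      using sets by (subst nn_integral_cmult_indicator)
        (auto simp: emeasure_eq_measure ennreal_mult T'_def intro!: borel_closed)
    also have "\<dots> \<le> smear Q \<epsilon> (power_kernel p q) x"
      unfolding smear_def
    proof (rule nn_integral_mono)
      fix w :: 'a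
      show "ennreal (2 * T') * indicator (cball 0 M) w \<le> power_kernel p q (x - \<epsilon> *\<^sub>R w)"
      proof (cases "norm w \<le> M")
        case True
        have "\<epsilon> * norm w \<le> 1 * norm w" using \<epsilon> by (intro mult_right_mono) auto
        then have "s \<le> norm (x - \<epsilon> *\<^sub>R w)"
          using norm_triangle_ineq2[of x "\<epsilon> *\<^sub>R w"] x \<epsilon> True by simp
        then have "2 * T' \<le> norm (x - \<epsilon> *\<^sub>R w) powr q / q"
          unfolding s(2)[symmetric] using s q by (intro divide_right_mono powr_mono2) auto
        then have "ennreal (2 * T') \<le> power_kernel p q (x - \<epsilon> *\<^sub>R w)"
          unfolding power_kernel_eq_riesz[OF p q] by (intro add_increasing2 ennreal_leI) auto
        then show ?thesis by (simp add: indicator_def)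
      qed simp
    qed
    finally show "ennreal T \<le> smear Q \<epsilon> (power_kernel p q) x" .
  qed
qed

lemma uniform_measure_in_P2:
  assumes \<mu>: "\<mu> \<in> P2" and A: "A \<in> sets borel" "emeasure \<mu> A \<noteq> 0"
  shows "uniform_measure \<mu> A \<in> P2"
proof -
  have [measurable_cong]: "sets \<mu> = sets borel" and "prob_space \<mu>"
    and fin: "(\<integral>\<^sup>+x. ennreal ((norm x)\<^sup>2) \<partial>\<mu>) < \<infinity>" using \<mu> by (auto simp: P2_iff)
  then interpret prob_space \<mu> by simp
  note A(1) [measurable]
  have "(\<integral>\<^sup>+x. ennreal ((norm x)\<^sup>2) \<partial>uniform_measure \<mu> A)
      = (\<integral>\<^sup>+x\<in>A. ennreal ((norm x)\<^sup>2) \<partial>\<mu>) / emeasure \<mu> A"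
    by (rule nn_integral_uniform_measure) auto
  also have "\<dots> \<le> (\<integral>\<^sup>+x. ennreal ((norm x)\<^sup>2) \<partial>\<mu>) / emeasure \<mu> A"
    by (intro divide_right_mono_ennreal nn_integral_mono) (simp add: indicator_def)
  also have "\<dots> < \<infinity>" using fin A(2) by (simp add: ennreal_divide_eq_top_iff less_top[symmetric])
  finally show ?thesis
    using A(2) \<open>sets \<mu> = sets borel\<close>
    by (auto simp: P2_iff intro!: prob_space_uniform_measure)
qed

lemma energy_uniform_measure:
  assumes "prob_space \<mu>" and [measurable_cong]: "sets \<mu> = sets borel"
    and [measurable]: "W \<in> borel_measurable borel" "A \<in> sets borel"
  shows "energy W (uniform_measure \<mu> A)
    = (\<integral>\<^sup>+y\<in>A. (\<integral>\<^sup>+x\<in>A. W (x - y) \<partial>\<mu>) \<partial>\<mu>) / emeasure \<mu> A / emeasure \<mu> A"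
proof -
  interpret prob_space \<mu> by fact
  have "energy W (uniform_measure \<mu> A)
      = (\<integral>\<^sup>+y. (\<integral>\<^sup>+x\<in>A. W (x - y) \<partial>\<mu>) / emeasure \<mu> A \<partial>uniform_measure \<mu> A)"
    unfolding energy_def by (intro nn_integral_cong nn_integral_uniform_measure) auto
  also have "\<dots> = (\<integral>\<^sup>+y\<in>A. ((\<integral>\<^sup>+x\<in>A. W (x - y) \<partial>\<mu>) / emeasure \<mu> A) \<partial>\<mu>) / emeasure \<mu> A"
    by (rule nn_integral_uniform_measure) auto
  also have "(\<integral>\<^sup>+y\<in>A. ((\<integral>\<^sup>+x\<in>A. W (x - y) \<partial>\<mu>) / emeasure \<mu> A) \<partial>\<mu>)
      = (\<integral>\<^sup>+y. ((\<integral>\<^sup>+x\<in>A. W (x - y) \<partial>\<mu>) * indicator A y) / emeasure \<mu> A \<partial>\<mu>)"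
    by (intro nn_integral_cong) (simp add: divide_ennreal_def mult_ac)
  also have "\<dots> = (\<integral>\<^sup>+y\<in>A. (\<integral>\<^sup>+x\<in>A. W (x - y) \<partial>\<mu>) \<partial>\<mu>) / emeasure \<mu> A"
    by (rule nn_integral_divide) auto
  finally show ?thesis .
qed

text \<open>
  With \<open>a = \<mu>(A)\<close>, \<open>i\<close> the integral on the left and \<open>j\<close> the interaction of the complement of \<open>A\<close> with itself,
  nonnegativity of \<open>W\<close> gives \<open>i + j \<le> e\<close>. The normalized restriction to the complement has energy
  \<open>j / (1 - a)^2\<close>, which is at least \<open>e\<close> by minimality. Hence \<open>i \<le> e - (1 - a)^2 e \<le> 2 e a\<close>. The
  inequality replaces the Euler-Lagrange equation, which would give the factor 1 on the
  support.
\<close>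
lemma minimizer_interaction_le:
  fixes \<mu> :: "'a::euclidean_space measure"
  assumes \<mu>: "\<mu> \<in> P2" and [measurable]: "W \<in> borel_measurable borel" "A \<in> sets borel"
    and min: "\<And>\<nu>. \<nu> \<in> P2 \<Longrightarrow> energy W \<mu> \<le> energy W \<nu>"
    and fin: "energy W \<mu> = ennreal e" "e \<ge> 0" and A: "measure \<mu> A < 1"
  shows "(\<integral>\<^sup>+y\<in>A. (\<integral>\<^sup>+x. W (x - y) \<partial>\<mu>) \<partial>\<mu>) \<le> ennreal (2 * e * measure \<mu> A)"
proof -
  have sets [measurable_cong]: "sets \<mu> = sets borel" and "prob_space \<mu>"
    using \<mu> by (auto simp: P2_iff)
  then interpret prob_space \<mu> by simp
  let ?F = "\<lambda>y. \<integral>\<^sup>+x. W (x - y) \<partial>\<mu>"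
  define a where "a = measure \<mu> A"
  have a: "0 \<le> a" "a < 1" using A by (auto simp: a_def)
  have mA: "emeasure \<mu> (- A) = ennreal (1 - a)"
    using prob_compl[of A] sets sets_eq_imp_space_eq[OF sets]
    by (simp add: emeasure_eq_measure a_def Compl_eq_Diff_UNIV)
  define I J where "I = (\<integral>\<^sup>+y\<in>A. ?F y \<partial>\<mu>)" and "J = (\<integral>\<^sup>+y\<in>-A. (\<integral>\<^sup>+x\<in>-A. W (x - y) \<partial>\<mu>) \<partial>\<mu>)"
  have "J \<le> (\<integral>\<^sup>+y\<in>-A. ?F y \<partial>\<mu>)"
    unfolding J_def by (intro nn_integral_mono mult_right_mono) (auto simp: indicator_def)
  moreover have "energy W \<mu> = I + (\<integral>\<^sup>+y\<in>-A. ?F y \<partial>\<mu>)"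
    unfolding energy_def I_def
    by (subst nn_integral_add[symmetric]) (auto intro!: nn_integral_cong simp: indicator_def)
  ultimately have "I + J \<le> ennreal e" by (simp add: fin(1)[symmetric] add_left_mono)
  then have "I < \<infinity>" "J < \<infinity>" by (auto simp: less_top[symmetric] top_unique)
  then obtain i j where ij: "I = ennreal i" "J = ennreal j" "i \<ge> 0" "j \<ge> 0"
    by (cases I; cases J) auto
  have "i + j \<le> e" using \<open>I + J \<le> ennreal e\<close> ij fin(2) by (simp add: ennreal_plus[symmetric] del: ennreal_plus)
  have "ennreal e \<le> energy W (uniform_measure \<mu> (- A))"
    unfolding fin(1)[symmetric] using a mA by (intro min uniform_measure_in_P2 \<mu>) auto
  also have "\<dots> = ennreal (j / (1 - a) / (1 - a))"
    using a ij mA by (subst energy_uniform_measure) (auto simp: prob_space_axioms sets J_def[symmetric] divide_ennreal)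
  finally have "e \<le> j / (1 - a) / (1 - a)"
    using ij a by (subst (asm) ennreal_le_iff) auto
  then have "e * (1 - a) * (1 - a) \<le> j" using a by (simp add: pos_le_divide_eq)
  with \<open>i + j \<le> e\<close> have "i \<le> 2 * e * a - e * (a * a)" by (simp add: algebra_simps)
  also have "\<dots> \<le> 2 * e * a" using fin(2) by simp
  finally show ?thesis using ij by (simp add: I_def[symmetric] a_def ennreal_leI)
qed

text \<open>
  Some point \<open>y\<close> has potential at most \<open>B + 1\<close>, so by Markov's inequality the ball \<open>G\<close> of radius
  \<open>R\<close> around \<open>y\<close> carries at least half of the mass. Every point \<open>z\<close> at distance more than \<open>2 R\<close> from \<open>y\<close> is
  at distance at least \<open>R\<close> from \<open>G\<close>, so its potential is at least \<open>2 B + 1\<close>. Such points form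
  a null set, because the mean potential over them is at most \<open>2 B\<close>.
\<close>
lemma minimizer_supported_in_ball:
  fixes \<mu> :: "'a::euclidean_space measure"
  assumes \<mu>: "\<mu> \<in> P2" and W [measurable]: "W \<in> borel_measurable borel"
    and min: "\<And>\<nu>. \<nu> \<in> P2 \<Longrightarrow> energy W \<mu> \<le> energy W \<nu>"
    and B: "energy W \<mu> \<le> ennreal B" "B \<ge> 0"
    and R: "R > 0" "\<And>x. R \<le> norm x \<Longrightarrow> ennreal (4 * B + 2) \<le> W x"
  shows "\<exists>y. AE x in \<mu>. norm (x - y) \<le> 2 * R"
proof -
  have sets [measurable_cong]: "sets \<mu> = sets borel" and "prob_space \<mu>"
    using \<mu> by (auto simp: P2_iff)
  then interpret prob_space \<mu> by simp
  have space: "space \<mu> = UNIV" using sets_eq_imp_space_eq[OF sets] by simp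
  let ?F = "\<lambda>y. \<integral>\<^sup>+x. W (x - y) \<partial>\<mu>"
  obtain e where e: "energy W \<mu> = ennreal e" "e \<ge> 0" "e \<le> B"
    using B by (cases "energy W \<mu>" rule: ennreal_cases) (auto simp: top_unique)
  have "\<exists>y. ?F y \<le> ennreal (B + 1)"
  proof (rule ccontr)
    assume "\<not> ?thesis"
    then have "(\<integral>\<^sup>+y. ennreal (B + 1) \<partial>\<mu>) \<le> energy W \<mu>"
      unfolding energy_def by (intro nn_integral_mono) (auto simp: not_le less_imp_le)
    then have "ennreal (B + 1) \<le> ennreal B" using B(1) by (simp add: emeasure_space_1)
    then show False using B(2) by (subst (asm) ennreal_le_iff) auto
  qed
  then obtain y where y: "?F y \<le> ennreal (B + 1)" ..
  \<comment> \<open>Outside \<open>G\<close> the kernel is at least \<open>4 B + 2\<close>, hence at least twice the bound \<open>B + 1\<close>.\<close>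
  define G where "G = {x. norm (x - y) < R}"
  have [measurable]: "G \<in> sets borel" unfolding G_def by measurable
  have half: "1 / 2 \<le> measure \<mu> G"
  proof -
    have "(\<integral>\<^sup>+x. ennreal (4 * B + 2) * indicator (- G) x \<partial>\<mu>) \<le> ?F y"
      by (intro nn_integral_mono) (auto simp: indicator_def G_def R(2))
    then have "ennreal (4 * B + 2) * emeasure \<mu> (- G) \<le> ennreal (B + 1)"
      using y by (subst (asm) nn_integral_cmult_indicator) (auto intro: order_trans)
    then have "ennreal ((4 * B + 2) * measure \<mu> (- G)) \<le> ennreal (B + 1)"
      using B(2) by (subst ennreal_mult) (auto simp: emeasure_eq_measure)
    then have "(4 * B + 2) * measure \<mu> (- G) \<le> B + 1"
      using B(2) by (subst (asm) ennreal_le_iff) auto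
    also have "B + 1 \<le> (4 * B + 2) * (1 / 2)" using B(2) by simp
    finally have "measure \<mu> (- G) \<le> 1 / 2" using B(2) by (subst (asm) mult_le_cancel_left_pos) auto
    moreover have "measure \<mu> (- G) = 1 - measure \<mu> G"
      using prob_compl[of G] sets by (simp add: space Compl_eq_Diff_UNIV)
    ultimately show ?thesis by simp
  qed
  define A where "A = {x. 2 * R < norm (x - y)}"
  have [measurable]: "A \<in> sets borel" unfolding A_def by measurable
  have "measure \<mu> A + measure \<mu> G = measure \<mu> (A \<union> G)"
    using R(1) by (intro finite_measure_Union[symmetric]) (auto simp: A_def G_def)
  then have A1: "measure \<mu> A < 1" using half prob_le_1[of "A \<union> G"] by linarith
  have far: "ennreal (2 * B + 1) \<le> ?F z" if "z \<in> A" for z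
  proof -
    have "2 * B + 1 = (4 * B + 2) * (1 / 2)" by simp
    then have "ennreal (2 * B + 1) = ennreal ((4 * B + 2) * (1 / 2))" by (rule arg_cong)
    also have "\<dots> \<le> ennreal ((4 * B + 2) * measure \<mu> G)"
      using half B(2) by (intro ennreal_leI mult_left_mono) auto
    also have "\<dots> = (\<integral>\<^sup>+x. ennreal (4 * B + 2) * indicator G x \<partial>\<mu>)"
      using B(2) by (subst nn_integral_cmult_indicator) (auto simp: emeasure_eq_measure ennreal_mult)
    also have "\<dots> \<le> ?F z"
    proof (rule nn_integral_mono)
      fix x
      have "R \<le> norm (x - z)" if "x \<in> G"
        using that \<open>z \<in> A\<close> norm_triangle_ineq[of "x - y" "z - x"] by (simp add: G_def A_def norm_minus_commute)
      then show "ennreal (4 * B + 2) * indicator G x \<le> W (x - z)"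
        by (auto simp: indicator_def R(2))
    qed
    finally show ?thesis .
  qed
  have "ennreal ((2 * B + 1) * measure \<mu> A) = (\<integral>\<^sup>+z. ennreal (2 * B + 1) * indicator A z \<partial>\<mu>)"
    using B(2) by (subst nn_integral_cmult_indicator) (auto simp: emeasure_eq_measure ennreal_mult)
  also have "\<dots> \<le> (\<integral>\<^sup>+z\<in>A. ?F z \<partial>\<mu>)"
    by (intro nn_integral_mono) (auto simp: indicator_def far)
  also have "\<dots> \<le> ennreal (2 * e * measure \<mu> A)"
    by (rule minimizer_interaction_le[OF \<mu> _ _ min e(1,2) A1]) auto
  finally have "(2 * B + 1) * measure \<mu> A \<le> 2 * e * measure \<mu> A"
    using e by (subst (asm) ennreal_le_iff) auto
  also have "\<dots> \<le> 2 * B * measure \<mu> A" using e by (intro mult_right_mono) auto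
  finally have "measure \<mu> A \<le> 0" by (simp add: algebra_simps)
  then have "measure \<mu> A = 0" using measure_nonneg[of \<mu> A] by linarith
  then have "AE x in \<mu>. x \<notin> A" by (subst (asm) prob_eq_0) auto
  then show ?thesis by (intro exI[of _ y]) (auto simp: A_def not_less)
qed

lemma energy_translate:
  assumes "prob_space \<mu>" and [measurable_cong]: "sets \<mu> = sets borel"
    and [measurable]: "W \<in> borel_measurable borel"
  shows "energy W (translate t \<mu>) = energy W \<mu>"
proof -
  interpret prob_space \<mu> by fact
  have "energy W (translate t \<mu>) = (\<integral>\<^sup>+y. \<integral>\<^sup>+x. W (x + t - y) \<partial>\<mu> \<partial>translate t \<mu>)"
    unfolding energy_def translate_def
    by (intro nn_integral_cong nn_integral_distr) auto
  also have "\<dots> = (\<integral>\<^sup>+y. \<integral>\<^sup>+x. W (x + t - (y + t)) \<partial>\<mu> \<partial>\<mu>)"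
    unfolding translate_def by (rule nn_integral_distr) auto
  finally show ?thesis by (simp add: energy_def)
qed

section \<open>Passing to the limit\<close>

text \<open>
  Continuity into \<open>[0, \<infinity>]\<close> also at 0, where the repulsive part tends to infinity.
\<close>
lemma tendsto_power_kernel:
  fixes x :: "'a::euclidean_space"
  assumes p: "p < 0" and q: "0 < q" and X: "X \<longlonglongrightarrow> x"
  shows "(\<lambda>k. power_kernel p q (X k)) \<longlonglongrightarrow> power_kernel p q x"
proof (cases "x = 0")
  case False
  have "(\<lambda>k. ennreal (norm (X k) powr q / q - norm (X k) powr p / p))
      \<longlonglongrightarrow> ennreal (norm x powr q / q - norm x powr p / p)"
    using p q False by (intro tendsto_intros tendsto_ennrealI X) auto
  moreover have "\<forall>\<^sub>F k in sequentially.
      ennreal (norm (X k) powr q / q - norm (X k) powr p / p) = power_kernel p q (X k)"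
    using tendsto_imp_eventually_ne[OF X False] by eventually_elim (simp add: power_kernel_def)
  ultimately have "(\<lambda>k. power_kernel p q (X k)) \<longlonglongrightarrow> ennreal (norm x powr q / q - norm x powr p / p)"
    by (rule Lim_transform_eventually)
  then show ?thesis using False by (simp add: power_kernel_def)
next
  case True
  have "(\<lambda>k. power_kernel p q (X k)) \<longlonglongrightarrow> \<top>"
  proof (rule order_tendstoI)
    fix a :: ennreal assume "a < \<top>"
    then obtain r where r: "a = ennreal r" "r \<ge> 0" by (cases a rule: ennreal_cases) auto
    \<comment> \<open>The radius within which the repulsive part alone exceeds \<open>r + 1\<close>.\<close>
    define \<delta> where "\<delta> = (- p * (r + 1)) powr (1 / p)"
    have \<delta>: "\<delta> > 0" "\<delta> powr p = - p * (r + 1)"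
    proof -
      have "0 < - p * (r + 1)" using p r(2) by (intro mult_pos_pos) auto
      then show "\<delta> > 0" "\<delta> powr p = - p * (r + 1)"
        using p unfolding \<delta>_def powr_powr by auto
    qed
    have "\<forall>\<^sub>F k in sequentially. norm (X k) < \<delta>"
      using tendsto_norm[OF X] True \<delta>(1) by (intro order_tendstoD(2)) auto
    then show "\<forall>\<^sub>F k in sequentially. a < power_kernel p q (X k)"
    proof eventually_elim
      case (elim k)
      show ?case
      proof (cases "X k = 0")
        case True
        then show ?thesis using \<open>a < \<top>\<close> by (simp add: power_kernel_def)
      next
        case False
        then have "\<delta> powr p < norm (X k) powr p"
          using elim p by (intro powr_less_mono2_neg) auto
        then have "r + 1 < norm (X k) powr p / - p"
          unfolding \<delta>(2) using p by (simp add: field_simps)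
        moreover have "0 \<le> norm (X k) powr q / q" using q by simp
        ultimately have "r < norm (X k) powr q / q - norm (X k) powr p / p" by simp
        then show ?thesis using False r by (simp add: power_kernel_def ennreal_less_iff)
      qed
    qed
  qed simp
  then show ?thesis using True by (simp add: power_kernel_def)
qed

lemma energy_distr:
  assumes "prob_space \<Omega>" and [measurable]: "Y \<in> borel_measurable \<Omega>" "W \<in> borel_measurable borel"
  shows "energy W (distr \<Omega> borel Y) = (\<integral>\<^sup>+\<omega>. \<integral>\<^sup>+\<omega>'. W (Y \<omega>' - Y \<omega>) \<partial>\<Omega> \<partial>\<Omega>)"
proof -
  interpret prob_space \<Omega> by fact
  interpret D: prob_space "distr \<Omega> borel Y" by (rule prob_space_distr) simp
  have "energy W (distr \<Omega> borel Y) = (\<integral>\<^sup>+\<omega>. \<integral>\<^sup>+x. W (x - Y \<omega>) \<partial>distr \<Omega> borel Y \<partial>\<Omega>)"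
    unfolding energy_def by (rule nn_integral_distr) auto
  also have "\<dots> = (\<integral>\<^sup>+\<omega>. \<integral>\<^sup>+\<omega>'. W (Y \<omega>' - Y \<omega>) \<partial>\<Omega> \<partial>\<Omega>)"
    by (intro nn_integral_cong nn_integral_distr) auto
  finally show ?thesis .
qed

text \<open>
  The integrands \<open>K (Y k \<omega>' - Y k \<omega> - \<epsilon>s k w)\<close> converge to \<open>K (Z \<omega>' - Z \<omega>)\<close> for all \<open>\<omega>\<close>, \<open>\<omega>'\<close> and \<open>w\<close>;
  Fatou's lemma applies to each of the three integrals in turn.
\<close>
lemma energy_le_liminf_energy_smear:
  fixes Q :: "'a::euclidean_space measure"
  assumes p: "p < 0" and q: "0 < q"
    and Q: "prob_space Q" and sets [measurable_cong]: "sets Q = sets borel"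
    and \<Omega>: "prob_space \<Omega>" and Y [measurable]: "\<And>k. Y k \<in> borel_measurable \<Omega>" "Z \<in> borel_measurable \<Omega>"
    and lim: "\<And>\<omega>. \<omega> \<in> space \<Omega> \<Longrightarrow> (\<lambda>k. Y k \<omega>) \<longlonglongrightarrow> Z \<omega>"
    and \<epsilon>s: "\<epsilon>s \<longlonglongrightarrow> 0"
  shows "energy (power_kernel p q) (distr \<Omega> borel Z)
    \<le> liminf (\<lambda>k. energy (smear Q (\<epsilon>s k) (power_kernel p q)) (distr \<Omega> borel (Y k)))"
proof -
  interpret Q: prob_space Q by fact
  interpret \<Omega>: prob_space \<Omega> by fact
  let ?K = "power_kernel p q :: 'a \<Rightarrow> ennreal"
  let ?f = "\<lambda>k \<omega> \<omega>' w. ?K (Y k \<omega>' - Y k \<omega> - \<epsilon>s k *\<^sub>R w)"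
  have "energy ?K (distr \<Omega> borel Z) = (\<integral>\<^sup>+\<omega>. \<integral>\<^sup>+\<omega>'. \<integral>\<^sup>+w. ?K (Z \<omega>' - Z \<omega>) \<partial>Q \<partial>\<Omega> \<partial>\<Omega>)"
    by (simp add: energy_distr[OF \<Omega>] Q.emeasure_space_1)
  also have "\<dots> = (\<integral>\<^sup>+\<omega>. \<integral>\<^sup>+\<omega>'. \<integral>\<^sup>+w. liminf (\<lambda>k. ?f k \<omega> \<omega>' w) \<partial>Q \<partial>\<Omega> \<partial>\<Omega>)"
  proof (intro nn_integral_cong)
    fix \<omega> \<omega>' w assume "\<omega> \<in> space \<Omega>" "\<omega>' \<in> space \<Omega>"
    then have "(\<lambda>k. Y k \<omega>' - Y k \<omega> - \<epsilon>s k *\<^sub>R w) \<longlonglongrightarrow> Z \<omega>' - Z \<omega> - 0 *\<^sub>R w"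
      by (intro tendsto_intros lim \<epsilon>s)
    then have "(\<lambda>k. ?f k \<omega> \<omega>' w) \<longlonglongrightarrow> ?K (Z \<omega>' - Z \<omega>)"
      using tendsto_power_kernel[OF p q] by simp
    then show "?K (Z \<omega>' - Z \<omega>) = liminf (\<lambda>k. ?f k \<omega> \<omega>' w)"
      by (intro lim_imp_Liminf[symmetric]) auto
  qed
  also have "\<dots> \<le> (\<integral>\<^sup>+\<omega>. \<integral>\<^sup>+\<omega>'. liminf (\<lambda>k. \<integral>\<^sup>+w. ?f k \<omega> \<omega>' w \<partial>Q) \<partial>\<Omega> \<partial>\<Omega>)"
    by (intro nn_integral_mono nn_integral_liminf) measurable
  also have "\<dots> \<le> (\<integral>\<^sup>+\<omega>. liminf (\<lambda>k. \<integral>\<^sup>+\<omega>'. \<integral>\<^sup>+w. ?f k \<omega> \<omega>' w \<partial>Q \<partial>\<Omega>) \<partial>\<Omega>)"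
    by (intro nn_integral_mono nn_integral_liminf) measurable
  also have "\<dots> \<le> liminf (\<lambda>k. \<integral>\<^sup>+\<omega>. \<integral>\<^sup>+\<omega>'. \<integral>\<^sup>+w. ?f k \<omega> \<omega>' w \<partial>Q \<partial>\<Omega> \<partial>\<Omega>)"
    by (intro nn_integral_liminf) measurable
  also have "\<dots> = liminf (\<lambda>k. energy (smear Q (\<epsilon>s k) ?K) (distr \<Omega> borel (Y k)))"
    by (simp add: energy_distr[OF \<Omega>] measurable_smear[OF Q sets]) (simp add: smear_def)
  finally show ?thesis .
qed

text \<open>
  Random variables on a common space couple their laws.
\<close>
lemma dW_distr_le:
  fixes X Y :: "'b \<Rightarrow> 'a::euclidean_space"
  assumes [measurable]: "X \<in> borel_measurable \<Omega>" "Y \<in> borel_measurable \<Omega>"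
    and fin: "(\<integral>\<^sup>+\<omega>. ennreal ((norm (X \<omega> - Y \<omega>))\<^sup>2) \<partial>\<Omega>) < \<infinity>"
  shows "dW (distr \<Omega> borel X) (distr \<Omega> borel Y)
    \<le> sqrt (enn2real (\<integral>\<^sup>+\<omega>. ennreal ((norm (X \<omega> - Y \<omega>))\<^sup>2) \<partial>\<Omega>))"
proof -
  define \<gamma> where "\<gamma> = distr \<Omega> borel (\<lambda>\<omega>. (X \<omega>, Y \<omega>))"
  have [measurable]: "fst \<in> borel_measurable (borel :: ('a \<times> 'a) measure)"
    "snd \<in> borel_measurable (borel :: ('a \<times> 'a) measure)"
    by (intro borel_measurable_continuous_onI continuous_intros)+
  have XY [measurable]: "(\<lambda>\<omega>. (X \<omega>, Y \<omega>)) \<in> borel_measurable \<Omega>"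
    by (rule borel_measurable_Pair) auto
  have "\<gamma> \<in> couplings (distr \<Omega> borel X) (distr \<Omega> borel Y)"
    unfolding couplings_def \<gamma>_def mem_Collect_eq
  proof (intro conjI)
    show "distr (distr \<Omega> borel (\<lambda>\<omega>. (X \<omega>, Y \<omega>))) borel fst = distr \<Omega> borel X"
      by (subst distr_distr[OF _ XY]) (measurable, simp add: o_def)
    show "distr (distr \<Omega> borel (\<lambda>\<omega>. (X \<omega>, Y \<omega>))) borel snd = distr \<Omega> borel Y"
      by (subst distr_distr[OF _ XY]) (measurable, simp add: o_def)
  qed simp
  then have "(INF \<gamma>\<in>couplings (distr \<Omega> borel X) (distr \<Omega> borel Y). \<integral>\<^sup>+(x, y). ennreal ((norm (x - y))\<^sup>2) \<partial>\<gamma>)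
      \<le> (\<integral>\<^sup>+(x, y). ennreal ((norm (x - y))\<^sup>2) \<partial>\<gamma>)" by (rule INF_lower)
  also have "\<dots> = (\<integral>\<^sup>+\<omega>. ennreal ((norm (X \<omega> - Y \<omega>))\<^sup>2) \<partial>\<Omega>)"
    unfolding \<gamma>_def case_prod_beta
  proof (subst nn_integral_distr[OF XY])
    show "(\<lambda>z. ennreal ((norm (fst z - snd z))\<^sup>2)) \<in> borel_measurable (distr \<Omega> borel (\<lambda>\<omega>. (X \<omega>, Y \<omega>)))"
      unfolding measurable_distr_eq1
      by (intro measurable_compose[OF borel_measurable_continuous_onI measurable_ennreal] continuous_intros)
  qed simp
  finally show ?thesis
    unfolding dW_def using fin by (intro real_sqrt_le_mono enn2real_mono) auto
qed

lemma dW_tendsto_0: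
  fixes Y :: "nat \<Rightarrow> 'b \<Rightarrow> 'a::euclidean_space"
  assumes "prob_space \<Omega>" and Y [measurable]: "\<And>k. Y k \<in> borel_measurable \<Omega>" "Z \<in> borel_measurable \<Omega>"
    and lim: "\<And>\<omega>. \<omega> \<in> space \<Omega> \<Longrightarrow> (\<lambda>k. Y k \<omega>) \<longlonglongrightarrow> Z \<omega>"
    and bdd: "\<And>k \<omega>. norm (Y k \<omega>) \<le> B" "\<And>\<omega>. norm (Z \<omega>) \<le> B"
  shows "(\<lambda>k. dW (distr \<Omega> borel (Y k)) (distr \<Omega> borel Z)) \<longlonglongrightarrow> 0"
proof -
  interpret prob_space \<Omega> by fact
  define c where "c k = (\<integral>\<^sup>+\<omega>. ennreal ((norm (Y k \<omega> - Z \<omega>))\<^sup>2) \<partial>\<Omega>)" for k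
  have le: "ennreal ((norm (Y k \<omega> - Z \<omega>))\<^sup>2) \<le> ennreal ((2 * B)\<^sup>2)" for k \<omega>
    using norm_triangle_ineq4[of "Y k \<omega>" "Z \<omega>"] bdd(1)[of k \<omega>] bdd(2)[of \<omega>]
    by (intro ennreal_leI power_mono) auto
  have "c \<longlonglongrightarrow> (\<integral>\<^sup>+\<omega>. 0 \<partial>\<Omega>)"
    unfolding c_def
  proof (rule nn_integral_dominated_convergence)
    show "AE \<omega> in \<Omega>. ennreal ((norm (Y k \<omega> - Z \<omega>))\<^sup>2) \<le> ennreal ((2 * B)\<^sup>2)" for k
      by (rule AE_I2[OF le])
    show "AE \<omega> in \<Omega>. (\<lambda>k. ennreal ((norm (Y k \<omega> - Z \<omega>))\<^sup>2)) \<longlonglongrightarrow> 0"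
    proof (rule AE_I2)
      fix \<omega> assume "\<omega> \<in> space \<Omega>"
      then have "(\<lambda>k. ennreal ((norm (Y k \<omega> - Z \<omega>))\<^sup>2)) \<longlonglongrightarrow> ennreal ((norm (Z \<omega> - Z \<omega>))\<^sup>2)"
        by (intro tendsto_intros tendsto_ennrealI lim)
      then show "(\<lambda>k. ennreal ((norm (Y k \<omega> - Z \<omega>))\<^sup>2)) \<longlonglongrightarrow> 0" by simp
    qed
    show "(\<integral>\<^sup>+\<omega>. ennreal ((2 * B)\<^sup>2) \<partial>\<Omega>) < \<infinity>" by (simp add: emeasure_space_1)
  qed measurable
  then have "c \<longlonglongrightarrow> 0" by simp
  then have "(\<lambda>k. enn2real (c k)) \<longlonglongrightarrow> enn2real 0"
    using tendsto_enn2real[where u = c and l = 0 and F = sequentially] by simp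
  then have "(\<lambda>k. sqrt (enn2real (c k))) \<longlonglongrightarrow> sqrt (enn2real 0)"
    by (rule tendsto_real_sqrt)
  then have lim0: "(\<lambda>k. sqrt (enn2real (c k))) \<longlonglongrightarrow> 0" by simp
  have fin: "c k < \<infinity>" for k
  proof -
    have "c k \<le> (\<integral>\<^sup>+\<omega>. ennreal ((2 * B)\<^sup>2) \<partial>\<Omega>)" unfolding c_def by (intro nn_integral_mono le)
    also have "\<dots> < \<infinity>" by (simp add: emeasure_space_1)
    finally show ?thesis .
  qed
  have upper: "dW (distr \<Omega> borel (Y k)) (distr \<Omega> borel Z) \<le> sqrt (enn2real (c k))" for k
    using fin[of k] unfolding c_def by (intro dW_distr_le Y)
  have lower: "0 \<le> dW (distr \<Omega> borel (Y k)) (distr \<Omega> borel Z)" for k by (simp add: dW_def)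
  show ?thesis
    by (rule tendsto_sandwich[OF _ _ tendsto_const lim0]) (intro always_eventually allI lower upper)+
qed

lemma ennreal_le_if_le_all_multiples:
  fixes a b :: ennreal
  assumes "\<And>\<kappa>. 1 < \<kappa> \<Longrightarrow> a \<le> ennreal \<kappa> * b"
  shows "a \<le> b"
proof (rule LIMSEQ_le_const)
  have "(\<lambda>n. 1 + inverse (real (Suc n))) \<longlonglongrightarrow> 1 + 0"
    by (intro tendsto_intros LIMSEQ_inverse_real_of_nat)
  then have "(\<lambda>n. ennreal (1 + inverse (real (Suc n)))) \<longlonglongrightarrow> ennreal 1"
    by (intro tendsto_ennrealI) simp
  then have "(\<lambda>n. ennreal (1 + inverse (real (Suc n))) * b) \<longlonglongrightarrow> ennreal 1 * b"
    by (intro tendsto_mult_ennreal tendsto_const) auto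
  then show "(\<lambda>n. ennreal (1 + inverse (real (Suc n))) * b) \<longlonglongrightarrow> b" by simp
  show "\<exists>N. \<forall>n\<ge>N. a \<le> ennreal (1 + inverse (real (Suc n))) * b"
    by (intro exI[of _ 0] allI impI assms) simp
qed

section \<open>Convergence of the minimizers\<close>

theorem corollary3p7:
  fixes p q l C \<epsilon>0 :: real
    and \<phi> :: "real ^ 'n \<Rightarrow> real"
    and \<mu>\<epsilon> :: "real \<Rightarrow> (real ^ 'n) measure"
  assumes "2 - real CARD('n) \<le> p" and "p < 0" and "0 < q" and "q \<le> 2"
    and "smooth \<phi>" and "radial \<phi>" and "\<forall>x. \<phi> x \<ge> 0"
    and "has_bochner_integral lborel \<phi> 1"
    and "l \<ge> max (2 * real CARD('n) + 1) 4" and "C > 0"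
    and "\<forall>x. x \<noteq> 0 \<longrightarrow> \<phi> x \<le> C * norm x powr (- l)"
    and "\<epsilon>0 > 0"
    and "\<forall>\<epsilon>\<in>{0<..<\<epsilon>0}. is_arg_min (energy (kernel_eps p q \<phi> \<epsilon>)) (\<lambda>\<nu>. \<nu> \<in> P2) (\<mu>\<epsilon> \<epsilon>)"
  shows "\<exists>\<mu>\<in>P2.
           (\<exists>(\<epsilon>s :: nat \<Rightarrow> real) (y :: nat \<Rightarrow> real ^ 'n).
              (\<forall>k. \<epsilon>s k \<in> {0<..<\<epsilon>0}) \<and> \<epsilon>s \<longlonglongrightarrow> 0 \<and>
              (\<lambda>k. dW (translate (y k) (\<mu>\<epsilon> (\<epsilon>s k))) \<mu>) \<longlonglongrightarrow> 0) \<and>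
           is_arg_min (energy (power_kernel p q)) (\<lambda>\<nu>. \<nu> \<in> P2) \<mu>"
proof -
  let ?d = "real DIM(real ^ 'n)"
  let ?K = "power_kernel p q :: real ^ 'n \<Rightarrow> ennreal"
  let ?P = "density lborel \<phi>"
  have d: "?d = real CARD('n)" by simp
  have p: "- ?d < p" "p < 0" and q: "0 < q" and C: "C > 0"
    and decay: "\<And>x. x \<noteq> 0 \<Longrightarrow> \<phi> x \<le> C * norm x powr - l" and nonneg: "\<And>x. 0 \<le> \<phi> x"
    using assms unfolding d by auto
  have l: "?d + 1 \<le> l" "?d + q < l" using assms unfolding d by auto
  have cont: "continuous_on UNIV \<phi>"
    using \<open>smooth \<phi>\<close> Ck.simps(1)[of \<phi>] unfolding smooth_def by blast
  then have m\<phi> [measurable]: "\<phi> \<in> borel_measurable borel" by (rule borel_measurable_continuous_onI)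
  have prob_P: "prob_space ?P"
  proof
    have "(\<integral>\<^sup>+x. ennreal (\<phi> x) \<partial>lborel) = ennreal 1"
      using assms(8) nonneg
      by (subst nn_integral_eq_integral) (auto simp: has_bochner_integral_iff)
    then show "emeasure ?P (space ?P) = 1" by (simp add: emeasure_density)
  qed
  define Q where "Q = (?P \<star> ?P)"
  have Q: "prob_space Q" "sets Q = sets borel"
    unfolding Q_def using prob_P by (auto intro: prob_space_convolution)
  have decay_Q: "power_decay m Q" if m: "0 \<le> m" "m \<le> l" for m
  proof -
    obtain A where "A \<ge> 0" "\<And>x. x \<noteq> 0 \<Longrightarrow> \<phi> x \<le> A * norm x powr - m"
      using decaying_density_bound[OF cont C decay m] by blast
    then have "power_decay m ?P" using m by (intro power_decay_density) auto
    then show ?thesis unfolding Q_def using prob_P by (intro power_decay_convolution) auto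
  qed
  have decay_d: "power_decay ?d Q" "power_decay (?d + 1) Q"
    by (intro decay_Q; use l in simp)+
  have moment: "(\<integral>\<^sup>+w. ennreal (norm w powr q) \<partial>Q) < \<infinity>"
    unfolding Q_def using density_moment_finite[OF m\<phi> prob_P C decay q l(2)]
    by (intro convolution_moment_finite prob_P q) auto
  have kernel: "kernel_eps p q \<phi> \<epsilon> = smear Q \<epsilon> ?K" if "\<epsilon> > 0" for \<epsilon>
    unfolding Q_def by (rule kernel_eps_eq_smear[OF m\<phi> nonneg prob_P that])
  have mK: "smear Q \<epsilon> ?K \<in> borel_measurable borel" for \<epsilon>
    by (rule measurable_smear[OF Q measurable_power_kernel])
  have min: "\<mu>\<epsilon> \<epsilon> \<in> P2" "\<And>\<nu>. \<nu> \<in> P2 \<Longrightarrow> energy (smear Q \<epsilon> ?K) (\<mu>\<epsilon> \<epsilon>) \<le> energy (smear Q \<epsilon> ?K) \<nu>"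
    if "\<epsilon> \<in> {0<..<\<epsilon>0}" for \<epsilon>
  proof -
    have "is_arg_min (energy (smear Q \<epsilon> ?K)) (\<lambda>\<nu>. \<nu> \<in> P2) (\<mu>\<epsilon> \<epsilon>)"
      using assms(13) that kernel[of \<epsilon>] by force
    then show "\<mu>\<epsilon> \<epsilon> \<in> P2" "\<And>\<nu>. \<nu> \<in> P2 \<Longrightarrow> energy (smear Q \<epsilon> ?K) (\<mu>\<epsilon> \<epsilon>) \<le> energy (smear Q \<epsilon> ?K) \<nu>"
      by (auto simp: is_arg_min_linorder)
  qed

  \<comment> \<open>A competitor of finite energy bounds the minimal energies, hence confines the minimizers.\<close>
  obtain \<nu>0 :: "(real ^ 'n) measure" where \<nu>0: "\<nu>0 \<in> P2" "energy ?K \<nu>0 < \<infinity>"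
    using uniform_ball_finite_energy[OF p q] by blast
  then obtain B where B: "B \<ge> 0" "\<And>\<epsilon>. \<epsilon> \<in> {0<..1} \<Longrightarrow> energy (smear Q \<epsilon> ?K) \<nu>0 \<le> ennreal B"
    using energy_smear_bounded[OF p q Q decay_d moment, of \<nu>0] unfolding P2_iff by blast
  obtain R where R: "R > 0" "\<And>\<epsilon> x. \<epsilon> \<in> {0<..1} \<Longrightarrow> R \<le> norm x \<Longrightarrow> ennreal (4 * B + 2) \<le> smear Q \<epsilon> ?K x"
    using smear_power_kernel_coercive[OF p(2) q Q, of "4 * B + 2"] by blast
  have "\<exists>y. AE x in \<mu>\<epsilon> \<epsilon>. norm (x - y) \<le> 2 * R" if \<epsilon>: "\<epsilon> \<in> {0<..<\<epsilon>0}" "\<epsilon> \<le> 1" for \<epsilon>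
  proof (rule minimizer_supported_in_ball[OF min(1)[OF \<epsilon>(1)] mK min(2)[OF \<epsilon>(1)] _ B(1) R(1)])
    show "energy (smear Q \<epsilon> ?K) (\<mu>\<epsilon> \<epsilon>) \<le> ennreal B"
      using min(2)[OF \<epsilon>(1) \<nu>0(1)] B(2)[of \<epsilon>] \<epsilon> by (auto intro: order_trans)
  qed (use R(2)[of \<epsilon>] \<epsilon> in auto)
  then have "\<forall>\<epsilon>. \<exists>y. \<epsilon> \<in> {0<..<\<epsilon>0} \<and> \<epsilon> \<le> 1 \<longrightarrow> (AE x in \<mu>\<epsilon> \<epsilon>. norm (x - y) \<le> 2 * R)" by blast
  from choice[OF this] obtain y where
    y: "\<And>\<epsilon>. \<epsilon> \<in> {0<..<\<epsilon>0} \<Longrightarrow> \<epsilon> \<le> 1 \<Longrightarrow> AE x in \<mu>\<epsilon> \<epsilon>. norm (x - y \<epsilon>) \<le> 2 * R" by blast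

  \<comment> \<open>The translated minimizers along a sequence tending to 0 all live in the ball of radius \<open>2 R\<close>.\<close>
  define \<epsilon>1 where "\<epsilon>1 = min 1 (\<epsilon>0 / 2)"
  define e where "e k = \<epsilon>1 * inverse (real (Suc k))" for k
  have \<epsilon>1: "0 < \<epsilon>1" "\<epsilon>1 \<le> 1" "\<epsilon>1 < \<epsilon>0" using \<open>\<epsilon>0 > 0\<close> by (auto simp: \<epsilon>1_def)
  have e: "e k \<in> {0<..<\<epsilon>0}" "e k \<le> 1" for k
  proof -
    have "e k \<le> \<epsilon>1 * 1" unfolding e_def using \<epsilon>1 by (intro mult_left_mono) (auto simp: inverse_le_1_iff)
    moreover have "0 < e k" using \<epsilon>1 by (simp add: e_def)
    ultimately show "e k \<in> {0<..<\<epsilon>0}" "e k \<le> 1" using \<epsilon>1 by auto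
  qed
  have e0: "e \<longlonglongrightarrow> 0"
    unfolding e_def using tendsto_mult[OF tendsto_const LIMSEQ_inverse_real_of_nat, of \<epsilon>1] by simp
  define M where "M k = translate (- y (e k)) (\<mu>\<epsilon> (e k))" for k
  have \<mu>: "prob_space (\<mu>\<epsilon> (e k))" "sets (\<mu>\<epsilon> (e k)) = sets borel" for k
    using min(1)[OF e(1)] by (auto simp: P2_iff)
  have shift [measurable]: "(\<lambda>x. x + t) \<in> borel_measurable (\<mu>\<epsilon> (e k))" for k and t :: "real ^ 'n"
    using \<mu>(2)[of k] by (simp cong: measurable_cong_sets)
  have M: "prob_space (M k)" "sets (M k) = sets borel" for k
    unfolding M_def translate_def by (rule prob_space.prob_space_distr[OF \<mu>(1) shift]) simp
  have M_bdd: "AE x in M k. norm x \<le> 2 * R" for k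
    unfolding M_def translate_def using y[OF e, of k] by (subst AE_distr_iff[OF shift]) auto
  obtain r :: "nat \<Rightarrow> nat" and \<Omega> :: "real measure" and Y Z B' where r: "strict_mono r"
    and \<Omega>: "prob_space \<Omega>" and Y: "\<And>k. Y k \<in> borel_measurable \<Omega>" "Z \<in> borel_measurable \<Omega>"
    and law: "\<And>k. distr \<Omega> borel (Y k) = M (r k)"
    and lim: "\<And>\<omega>. \<omega> \<in> space \<Omega> \<Longrightarrow> (\<lambda>k. Y k \<omega>) \<longlonglongrightarrow> Z \<omega>"
    and bdd: "\<And>k \<omega>. norm (Y k \<omega>) \<le> B'" "\<And>\<omega>. norm (Z \<omega>) \<le> B'"
    using skorohod_representation_bounded[of M, OF M M_bdd] by (elim exE conjE) blast
  define \<mu> where "\<mu> = distr \<Omega> borel Z"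
  define \<epsilon>s where "\<epsilon>s k = e (r k)" for k
  have \<epsilon>s: "\<And>k. \<epsilon>s k \<in> {0<..<\<epsilon>0}" "\<epsilon>s \<longlonglongrightarrow> 0"
    using e LIMSEQ_subseq_LIMSEQ[OF e0 r] by (auto simp: \<epsilon>s_def[abs_def] o_def)
  have "\<mu> \<in> P2"
  proof (rule P2_if_bounded[of _ B'])
    show "prob_space \<mu>" unfolding \<mu>_def by (rule prob_space.prob_space_distr[OF \<Omega> Y(2)])
    show "AE x in \<mu>. norm x \<le> B'"
      unfolding \<mu>_def using bdd(2) Y(2) by (subst AE_distr_iff) auto
  qed (simp add: \<mu>_def)
  moreover have "(\<lambda>k. dW (translate (- y (\<epsilon>s k)) (\<mu>\<epsilon> (\<epsilon>s k))) \<mu>) \<longlonglongrightarrow> 0"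
    using dW_tendsto_0[OF \<Omega> Y lim bdd] by (simp add: law M_def \<mu>_def \<epsilon>s_def)
  moreover have "energy ?K \<mu> \<le> energy ?K \<nu>" if \<nu>: "\<nu> \<in> P2" for \<nu>
  proof (cases "energy ?K \<nu> < \<infinity>")
    case True
    show ?thesis
    proof (rule ennreal_le_if_le_all_multiples)
      fix \<kappa> :: real assume \<kappa>: "1 < \<kappa>"
      have "energy ?K \<mu> \<le> liminf (\<lambda>k. energy (smear Q (\<epsilon>s k) ?K) (M (r k)))"
        using energy_le_liminf_energy_smear[OF p(2) q Q \<Omega> Y lim \<epsilon>s(2)] by (simp add: law \<mu>_def)
      also have "\<dots> = liminf (\<lambda>k. energy (smear Q (\<epsilon>s k) ?K) (\<mu>\<epsilon> (\<epsilon>s k)))"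
        unfolding M_def \<epsilon>s_def using \<mu> mK by (simp add: energy_translate)
      also have "\<dots> \<le> liminf (\<lambda>k. energy (smear Q (\<epsilon>s k) ?K) \<nu>)"
        using min(2)[OF \<epsilon>s(1) \<nu>] by (intro Liminf_mono always_eventually) auto
      also have "\<dots> \<le> limsup (\<lambda>k. energy (smear Q (\<epsilon>s k) ?K) \<nu>)"
        by (rule Liminf_le_Limsup) simp
      also have "\<dots> \<le> ennreal \<kappa> * energy ?K \<nu>"
        using \<nu> \<epsilon>s True \<kappa>
        by (intro energy_smear_limsup[OF p q Q decay_d moment]) (auto simp: P2_iff)
      finally show "energy ?K \<mu> \<le> ennreal \<kappa> * energy ?K \<nu>" .
    qed
  qed (simp add: less_top[symmetric])
  ultimately show ?thesis
    using \<epsilon>s by (intro bexI[of _ \<mu>] conjI exI[of _ \<epsilon>s] exI[of _ "\<lambda>k. - y (\<epsilon>s k)"])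
      (auto simp: is_arg_min_linorder)
qed

end
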